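(* Let $M$ be an irreducible generator on the finite set $\mathcal X$ and $\xi:\mathcal X\to\mathcal Y$ a coarse-graining map. Let $\mu\in C^1([0,\infty);\mathcal P(\mathcal X))$ be a solution to the full forward Kolmogorov equation $\frac{\mathrm d}{\mathrm dt}\mu_t=M^T\mu_t$ with initial condition $\mu_0$ and corresponding coarse-grained dynamics $\hat\mu_t=\xi_\#\mu_t$, and let $\eta\in C^1([0,\infty);\mathcal P(\mathcal Y))$ be the solution to the effective dynamics $\frac{\mathrm d}{\mathrm dt}\eta_t=N^T\eta_t$ with initial condition $\eta_0$, where $\hat\mu_0,\eta_0\in\mathcal P_+(\mathcal Y)$ satisfy $\hat\mu_0(y),\eta_0(y)\ge c_0$ for some $c_0>0$ and all $y\in\mathcal Y$. Then for any fixed $T>0$ there exists a constant $C=C(M,|\mathcal X|,T,c_0)$ such that $$\mathscr H_{\eta_t}\Bigl(\frac{\hat\mu_t}{\eta_t}\Bigr)\le2\,\mathscr H_{\eta_0}\Bigl(\frac{\hat\mu_0}{\eta_0}\Bigr)+\frac{C}{\min_{y\in\mathcal Y}\alpha_{\mathrm{gLSI}}(\rho(\cdot|y),M^y)}\Bigl[\mathscr H_\rho\Bigl(\frac{\mu_0}\rho\Bigr)-\mathscr H_\rho\Bigl(\frac{\mu_t}\rho\Bigr)\Bigr]$$ for all $t\in[0,T]$. In particular, the implicit prefactor $\min_{y}\alpha_{\mathrm{gLSI}}(\rho(\cdot|y),M^y)$ can be replaced by the explicit constant $\alpha>0$ given by $$\alpha=\min_{y\in\mathcal Y}\frac{\l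ambda_y}{2+\log\frac1{\rho(\cdot|y)_*}}.$$
   Context: $\mathcal X,\mathcal Y$ are finite sets, $\xi:\mathcal X\to\mathcal Y$ is a map, and $\Lambda_y=\xi^{-1}(y)$ are its level sets. A generator on a finite set is a real matrix with off-diagonal entries $\ge0$ and rows summing to $0$; reversibility is not assumed. $\mathcal P(\cdot)$, $\mathcal P_+(\cdot)$ denote probability measures and strictly positive probability measures. For a strictly positive probability measure $\zeta$ on a finite set, the relative entropy is $\mathscr H_\zeta(\varphi)=\sum_z\varphi(z)\log\varphi(z)\,\zeta(z)$ (with $0\log0=0$). $\rho\in\mathcal P_+(\mathcal X)$ is the unique steady state of $M$ ($M^T\rho=0$). For $x\in\Lambda_y$ the conditional measure is $\rho(x|y)=\rho(x)/\sum_{x'\in\Lambda_y}\rho(x')$, and $\rho(\cdot|y)_*=\min_{x\in\Lambda_y}\rho(x|y)$. The coarse-grained dynamics is $\hat\mu_t(y)=\sum_{x\in\Lambda_y}\mu_t(x)$. The effective generator on $\mathcal Y$ is $$N(y_1,y_2)=\sum_{x_1\in\Lambda_{y_1},\,x_2\in\Lambda_{y_2}}M(x_1,x_2)\rho(x_1|y_1).$$ $M^y$ is the restriction of $M$ to $\Lambda_y\times\Lambda_y$ with diagonal modified so that it is again a generator: $M^y(x,x')=M(x,x')$ for $x\ne x'$ in $\Lambda_y$ and $M^y(x,x)=-\sum_{x'\in\Lambda_y,\,x'\ne x}M(x,x')$. For a generator $K$ on a finite set $\Lambda$ and $\zeta\in\mathcal P_+(\Lambda)$, the generalised log-Sobolev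 constant is $$\alpha_{\mathrm{gLSI}}(\zeta,K)=\inf_{\varphi}\frac{\sum_{z,z'\in\Lambda}K(z,z')\zeta(z)\varphi(z)\bigl[\frac{\varphi(z')}{\varphi(z)}-1-\log\frac{\varphi(z')}{\varphi(z)}\bigr]}{\mathscr H_\zeta(\varphi)},$$ the infimum being over $\varphi:\Lambda\to(0,\infty)$ with $\sum_z\varphi(z)\zeta(z)=1$ and $\varphi$ not identically $1$. $\lambda_y$ is the spectral gap of the symmetrisation $S$ of $M^y$ with respect to $\zeta=\rho(\cdot|y)$, where $S$ is the generator on $\Lambda_y$ with off-diagonal entries $S(x,x')=\frac12\bigl(M^y(x,x')+\frac{\zeta(x')}{\zeta(x)}M^y(x',x)\bigr)$, $x\ne x'$, and rows summing to $0$. Here the spectral gap is the Poincaré constant of $S$, i.e. the infimum over non-constant $f:\Lambda_y\to\mathbb R$ of $\frac12\sum_{x,x'}S(x,x')\zeta(x)(f(x)-f(x'))^2$ divided by the variance of $f$ under $\zeta$.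
   Formalization: α>0 is claimed only if every M^y is irreducible or min_y α_gLSI>0, since it can fail (chain 1–2–3 with level set {1,3} gives M^y=0, α=0); both bounds are read with C/0=∞, ∞·0=0 and C/∞=0. *)

theory Defs
  imports Complex_Main "HOL-Library.Extended_Real" "HOL-Library.FuncSet"
begin

text \<open>
  Finite state spaces are finite carrier sets. Measures, densities and matrices are total functions
  of which only the values on the carrier matter.
\<close>

definition prob_on :: "'a set \<Rightarrow> ('a \<Rightarrow> real) set" where
  "prob_on A = {p. (\<forall>z\<in>A. 0 \<le> p z) \<and> (\<Sum>z\<in>A. p z) = 1}"

definition pos_prob_on :: "'a set \<Rightarrow> ('a \<Rightarrow> real) set" where
  "pos_prob_on A = {p \<in> prob_on A. \<forall>z\<in>A. 0 < p z}"

definition generator_on :: "'a set \<Rightarrow> ('a \<Rightarrow> 'a \<Rightarrow> real) \<Rightarrow> bool" where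
  "generator_on A K \<longleftrightarrow>
     (\<forall>x\<in>A. \<forall>x'\<in>A. x \<noteq> x' \<longrightarrow> 0 \<le> K x x') \<and> (\<forall>x\<in>A. (\<Sum>x'\<in>A. K x x') = 0)"

definition irreducible_on :: "'a set \<Rightarrow> ('a \<Rightarrow> 'a \<Rightarrow> real) \<Rightarrow> bool" where
  "irreducible_on A K \<longleftrightarrow>
     (\<forall>x\<in>A. \<forall>x'\<in>A. (x, x') \<in> {(u, v). u \<in> A \<and> v \<in> A \<and> 0 < K u v}\<^sup>*)"

definition steady_state_on :: "'a set \<Rightarrow> ('a \<Rightarrow> 'a \<Rightarrow> real) \<Rightarrow> ('a \<Rightarrow> real) \<Rightarrow> bool" where
  "steady_state_on A K p \<longleftrightarrow> (\<forall>x'\<in>A. (\<Sum>x\<in>A. K x x' * p x) = 0)"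

text \<open>
  Solutions in \<open>C\<^sup>1([0,\<infinity>); P(A))\<close> of \<open>p' = K\<^sup>T p\<close>, with a one-sided derivative at time 0.
  Continuity of the derivative is automatic from the equation.
\<close>

definition kolmogorov_solution ::
    "'a set \<Rightarrow> ('a \<Rightarrow> 'a \<Rightarrow> real) \<Rightarrow> (real \<Rightarrow> 'a \<Rightarrow> real) \<Rightarrow> bool" where
  "kolmogorov_solution A K p \<longleftrightarrow>
     (\<forall>t\<ge>0. p t \<in> prob_on A \<and>
        (\<forall>x'\<in>A. ((\<lambda>s. p s x') has_real_derivative (\<Sum>x\<in>A. K x x' * p t x)) (at t within {0..})))"

text \<open>The convention \<open>0 log 0 = 0\<close> holds because of the factor \<open>\<phi> z\<close>.\<close>

definition rel_entropy :: "'a set \<Rightarrow> ('a \<Rightarrow> real) \<Rightarrow> ('a \<Rightarrow> real) \<Rightarrow> real" where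
  "rel_entropy A \<zeta> \<phi> = (\<Sum>z\<in>A. \<phi> z * ln (\<phi> z) * \<zeta> z)"

definition level_set :: "'a set \<Rightarrow> ('a \<Rightarrow> 'b) \<Rightarrow> 'b \<Rightarrow> 'a set" where
  "level_set X \<xi> y = {x \<in> X. \<xi> x = y}"

definition coarse :: "'a set \<Rightarrow> ('a \<Rightarrow> 'b) \<Rightarrow> ('a \<Rightarrow> real) \<Rightarrow> 'b \<Rightarrow> real" where
  "coarse X \<xi> p y = (\<Sum>x\<in>level_set X \<xi> y. p x)"

definition cond_measure :: "'a set \<Rightarrow> ('a \<Rightarrow> 'b) \<Rightarrow> ('a \<Rightarrow> real) \<Rightarrow> 'b \<Rightarrow> 'a \<Rightarrow> real" where
  "cond_measure X \<xi> \<rho> y x = \<rho> x / (\<Sum>x'\<in>level_set X \<xi> y. \<rho> x')"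

definition effective_generator ::
    "'a set \<Rightarrow> ('a \<Rightarrow> 'b) \<Rightarrow> ('a \<Rightarrow> 'a \<Rightarrow> real) \<Rightarrow> ('a \<Rightarrow> real) \<Rightarrow> 'b \<Rightarrow> 'b \<Rightarrow> real" where
  "effective_generator X \<xi> M \<rho> y1 y2 =
     (\<Sum>x1\<in>level_set X \<xi> y1. \<Sum>x2\<in>level_set X \<xi> y2. M x1 x2 * cond_measure X \<xi> \<rho> y1 x1)"

definition restricted_generator :: "'a set \<Rightarrow> ('a \<Rightarrow> 'a \<Rightarrow> real) \<Rightarrow> 'a \<Rightarrow> 'a \<Rightarrow> real" where
  "restricted_generator A K x x' = (if x = x' then - (\<Sum>z\<in>A - {x}. K x z) else K x x')"

text \<open>
  The restriction to \<open>A\<close> is used here only to choose the diagonal so that rows sum to 0; it discards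
  the diagonal of the averaged matrix.
\<close>

definition symmetrised_generator ::
    "'a set \<Rightarrow> ('a \<Rightarrow> real) \<Rightarrow> ('a \<Rightarrow> 'a \<Rightarrow> real) \<Rightarrow> 'a \<Rightarrow> 'a \<Rightarrow> real" where
  "symmetrised_generator A \<zeta> K =
     restricted_generator A (\<lambda>x x'. (K x x' + \<zeta> x' / \<zeta> x * K x' x) / 2)"

text \<open>
  The two constants below are infima in the extended reals: on a one-point set there is no
  admissible function, and the infimum over the empty set is \<open>\<infinity>\<close>. For \<open>C > 0\<close>, extended-real
  division then gives \<open>C / \<infinity> = 0\<close> and \<open>C / 0 = \<infinity>\<close>. The value 0 occurs when a level set is not
  connected by the restricted generator, and \<open>\<infinity> * 0 = 0\<close>.
\<close>

definition gLSI :: "'a set \<Rightarrow> ('a \<Rightarrow> real) \<Rightarrow> ('a \<Rightarrow> 'a \<Rightarrow> real) \<Rightarrow> ereal" where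
  "gLSI A \<zeta> K =
     (INF \<phi>\<in>{\<phi>. (\<forall>z\<in>A. 0 < \<phi> z) \<and> (\<Sum>z\<in>A. \<phi> z * \<zeta> z) = 1 \<and> (\<exists>z\<in>A. \<phi> z \<noteq> 1)}.
        ereal ((\<Sum>z\<in>A. \<Sum>z'\<in>A. K z z' * \<zeta> z * \<phi> z * (\<phi> z' / \<phi> z - 1 - ln (\<phi> z' / \<phi> z)))
               / rel_entropy A \<zeta> \<phi>))"

definition variance_on :: "'a set \<Rightarrow> ('a \<Rightarrow> real) \<Rightarrow> ('a \<Rightarrow> real) \<Rightarrow> real" where
  "variance_on A \<zeta> f = (\<Sum>x\<in>A. (f x - (\<Sum>z\<in>A. f z * \<zeta> z))\<^sup>2 * \<zeta> x)"

definition poincare_constant :: "'a set \<Rightarrow> ('a \<Rightarrow> real) \<Rightarrow> ('a \<Rightarrow> 'a \<Rightarrow> real) \<Rightarrow> ereal" where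
  "poincare_constant A \<zeta> S =
     (INF f\<in>{f. \<exists>x\<in>A. \<exists>x'\<in>A. f x \<noteq> f x'}.
        ereal ((1 / 2 * (\<Sum>x\<in>A. \<Sum>x'\<in>A. S x x' * \<zeta> x * (f x - f x')\<^sup>2)) / variance_on A \<zeta> f))"

definition min_gLSI ::
    "'a set \<Rightarrow> 'b set \<Rightarrow> ('a \<Rightarrow> 'b) \<Rightarrow> ('a \<Rightarrow> 'a \<Rightarrow> real) \<Rightarrow> ('a \<Rightarrow> real) \<Rightarrow> ereal" where
  "min_gLSI X Y \<xi> M \<rho> =
     (MIN y\<in>Y. gLSI (level_set X \<xi> y) (cond_measure X \<xi> \<rho> y)
                     (restricted_generator (level_set X \<xi> y) M))"

definition level_gap ::
    "'a set \<Rightarrow> ('a \<Rightarrow> 'b) \<Rightarrow> ('a \<Rightarrow> 'a \<Rightarrow> real) \<Rightarrow> ('a \<Rightarrow> real) \<Rightarrow> 'b \<Rightarrow> ereal" where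
  "level_gap X \<xi> M \<rho> y =
     poincare_constant (level_set X \<xi> y) (cond_measure X \<xi> \<rho> y)
       (symmetrised_generator (level_set X \<xi> y) (cond_measure X \<xi> \<rho> y)
          (restricted_generator (level_set X \<xi> y) M))"

definition explicit_const ::
    "'a set \<Rightarrow> 'b set \<Rightarrow> ('a \<Rightarrow> 'b) \<Rightarrow> ('a \<Rightarrow> 'a \<Rightarrow> real) \<Rightarrow> ('a \<Rightarrow> real) \<Rightarrow> ereal" where
  "explicit_const X Y \<xi> M \<rho> =
     (MIN y\<in>Y. level_gap X \<xi> M \<rho> y
        / ereal (2 + ln (1 / (MIN x\<in>level_set X \<xi> y. cond_measure X \<xi> \<rho> y x))))"

end

theory Submission
  imports Defs
begin

text \<open>
  Write \<open>p = \<mu>\<^sub>t\<close>, \<open>m\<close> for its coarse-graining, \<open>g = m / \<eta>\<close>, and let \<open>q\<close> be the measure on \<open>X\<close> with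
  marginal \<open>m\<close> and conditional measures \<open>\<rho>(\<cdot>|y)\<close>. The time derivative of the relative entropy of
  \<open>m\<close> with respect to \<open>\<eta>\<close> is a sum over jumps \<open>x \<rightarrow> x'\<close> of
  \<open>M x x' * (p x * ln G - q x * (G - 1))\<close> with \<open>G = g (\<xi> x') / g (\<xi> x)\<close>. Maximising over \<open>G > 0\<close> bounds
  the bracket by \<open>p x * ln (p x / q x) - p x + q x\<close>, whatever the size of \<open>G\<close>, so the derivative is
  at most the total escape rate times the relative entropy of \<open>p\<close> with respect to \<open>q\<close>. The latter
  is the average of the entropies inside the level sets, and the log-Sobolev inequalities there
  bound it by the entropy production of the full chain. Integrating in time needs no Gronwall
  argument.

  When the log-Sobolev constant of some level set vanishes, the bound is only at stake if the
  entropy of \<open>\<mu>\<close> does not drop; there the level sets are replaced by \<open>X\<close>, on which \<open>M\<close> is irreducible.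
  Densities that vanish somewhere are treated by mixing \<open>\<mu>\<close> with \<open>\<epsilon> \<rho>\<close> and letting \<open>\<epsilon>\<close> tend to 0.
\<close>

section \<open>Entropy production and Dirichlet energy\<close>

text \<open>Diagonal entries of a generator are nonpositive, so there the two factors must agree.
  With this, double sums over all pairs can be compared term by term.\<close>

lemma offdiag_mult_mono:
  fixes K :: "'a \<Rightarrow> 'a \<Rightarrow> real"
  assumes "generator_on A K" "x \<in> A" "x' \<in> A" "x \<noteq> x' \<Longrightarrow> u \<le> v" "x = x' \<Longrightarrow> u = v"
  shows "K x x' * u \<le> K x x' * v"
  using assms by (cases "x = x'") (auto simp: generator_on_def intro!: mult_left_mono)

text \<open>For \<open>s = sqrt u\<close> this bounds \<open>u * ln u - u + 1\<close> by a multiple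
  of the squared distance of \<open>sqrt u\<close> from 1; the factor \<open>2 + L\<close> is the
  origin of the denominator in \<open>explicit_const\<close>. On either side of
  \<open>s = 1\<close>, where both sides vanish, a difference is shown to be monotone.\<close>

lemma mult_ln_le_hellinger:
  fixes s L :: real
  assumes "0 < s" "0 \<le> L" "2 * ln s \<le> L"
  shows "2 * s\<^sup>2 * ln s - s\<^sup>2 + 1 \<le> (2 + L) * (s - 1)\<^sup>2"
proof (cases "1 \<le> s")
  case True
  \<comment> \<open>\<open>k s\<close> is the right side minus the left side with \<open>L\<close>
    lowered to \<open>2 * ln s\<close>.\<close>
  define k where "k = (\<lambda>x::real. (x - 1) * (3 * x - 1) - 2 * (2 * x - 1) * ln x)"
  have "k 1 \<le> k s"
  proof (rule DERIV_nonneg_imp_nondecreasing[OF True, of k])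
    fix x :: real assume x: "1 \<le> x" "x \<le> s"
    have "(k has_real_derivative (3 * x - 1 + 3 * (x - 1) - (4 * ln x + 2 * (2 * x - 1) / x))) (at x)"
      unfolding k_def using x by (auto intro!: derivative_eq_intros)
    moreover have "3 * x - 1 + 3 * (x - 1) - (4 * ln x + 2 * (2 * x - 1) / x) = 6 * x - 8 - 4 * ln x + 2 / x"
      using x by (simp add: field_simps)
    ultimately have deriv: "(k has_real_derivative (6 * x - 8 - 4 * ln x + 2 / x)) (at x)"
      by metis
    have "2 * (x - 1)\<^sup>2 / x = 2 * x - 4 + 2 / x"
      using x by (simp add: field_simps power2_eq_square)
    moreover have "0 \<le> 2 * (x - 1)\<^sup>2 / x"
      using x by simp
    moreover have "ln x \<le> x - 1"
      using x by (intro ln_le_minus_one) simp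
    ultimately have "0 \<le> 6 * x - 8 - 4 * ln x + 2 / x"
      by linarith
    with deriv show "\<exists>y. (k has_real_derivative y) (at x) \<and> 0 \<le> y"
      by blast
  qed
  then have "2 * s\<^sup>2 * ln s - s\<^sup>2 + 1 \<le> (2 + 2 * ln s) * (s - 1)\<^sup>2"
    by (simp add: k_def algebra_simps power2_eq_square)
  also have "\<dots> \<le> (2 + L) * (s - 1)\<^sup>2"
    using assms by (intro mult_right_mono) auto
  finally show ?thesis .
next
  case False
  \<comment> \<open>For \<open>s < 1\<close> even \<open>L = 0\<close> suffices. In the variable
    \<open>v = 1 / s\<close>, \<open>s\<^sup>2 * h v\<close> is the right side minus the left side
    at \<open>L = 0\<close>.\<close>
  define h where "h = (\<lambda>v::real. v\<^sup>2 - 4 * v + 3 + 2 * ln v)"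
  have "h 1 \<le> h (1 / s)"
  proof (rule DERIV_nonneg_imp_nondecreasing[of _ _ h])
    show "1 \<le> 1 / s" using False assms by simp
    fix v :: real assume v: "1 \<le> v" "v \<le> 1 / s"
    have "(h has_real_derivative (2 * v - 4 + 2 / v)) (at v)"
      unfolding h_def using v by (auto intro!: derivative_eq_intros)
    moreover have "2 * v - 4 + 2 / v = 2 * (v - 1)\<^sup>2 / v"
      using v by (simp add: field_simps power2_eq_square)
    moreover have "0 \<le> 2 * (v - 1)\<^sup>2 / v"
      using v by simp
    ultimately show "\<exists>y. (h has_real_derivative y) (at v) \<and> 0 \<le> y"
      by metis
  qed
  then have "0 \<le> (1 / s)\<^sup>2 - 4 * (1 / s) + 3 - 2 * ln s"
    using assms by (simp add: h_def ln_div)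
  then have "0 \<le> s\<^sup>2 * ((1 / s)\<^sup>2 - 4 * (1 / s) + 3 - 2 * ln s)"
    by simp
  also have "\<dots> = 1 - 4 * s + 3 * s\<^sup>2 - 2 * s\<^sup>2 * ln s"
    using assms by (simp add: field_simps power2_eq_square)
  finally have "2 * s\<^sup>2 * ln s - s\<^sup>2 + 1 \<le> 2 * (s - 1)\<^sup>2"
    by (simp add: algebra_simps power2_eq_square)
  also have "\<dots> \<le> (2 + L) * (s - 1)\<^sup>2"
    using assms by (intro mult_right_mono) auto
  finally show ?thesis .
qed

text \<open>The tangent bound for the logarithm at \<open>1 / sqrt u\<close> gives
  \<open>u * ln u \<ge> 2 * (u - sqrt u)\<close>; completing the square does the rest.\<close>

lemma mult_ln_ge_hellinger:
  fixes u :: real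
  assumes "0 < u"
  shows "(sqrt u - 1)\<^sup>2 \<le> u * ln u - u + 1"
proof -
  have "ln (1 / sqrt u) \<le> 1 / sqrt u - 1"
    using assms by (intro ln_le_minus_one) auto
  then have "u * (1 - 1 / sqrt u) \<le> u * ln (sqrt u)"
    using assms by (intro mult_left_mono) (auto simp: ln_div)
  moreover have "u / sqrt u = sqrt u"
    using assms by (simp add: real_div_sqrt)
  ultimately show ?thesis
    using assms by (simp add: ln_sqrt algebra_simps power2_eq_square)
qed

text \<open>The tangent bound is applied to the square root of \<open>v / u\<close>. It makes
  entropy production dominate the Dirichlet energy of the root of the density.\<close>

lemma hellinger_le_Bregman:
  fixes u v :: real
  assumes "0 < u" "0 < v"
  shows "(sqrt v - sqrt u)\<^sup>2 \<le> u * (v / u - 1 - ln (v / u))"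
proof -
  have "ln (sqrt v / sqrt u) \<le> sqrt v / sqrt u - 1"
    using assms by (intro ln_le_minus_one) auto
  then have "ln (v / u) \<le> 2 * (sqrt v / sqrt u - 1)"
    using assms by (simp add: ln_sqrt ln_div)
  then have "u * (v / u - 1 - 2 * (sqrt v / sqrt u - 1)) \<le> u * (v / u - 1 - ln (v / u))"
    using assms by (intro mult_left_mono) auto
  moreover have "u * (v / u - 1 - 2 * (sqrt v / sqrt u - 1)) = (sqrt v - sqrt u)\<^sup>2"
  proof -
    have "u * (sqrt v / sqrt u) = sqrt u * sqrt v"
      using real_div_sqrt[of u] assms by (metis less_imp_le mult.commute times_divide_eq_left times_divide_eq_right)
    moreover have "u * (v / u - 1 - 2 * (sqrt v / sqrt u - 1)) = v + u - 2 * (u * (sqrt v / sqrt u))"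
      using assms by (simp add: algebra_simps)
    ultimately show ?thesis using assms by (simp add: power2_diff)
  qed
  ultimately show ?thesis by simp
qed

text \<open>An upper counterpart, from the tangent bound at the reciprocal ratio
  \<open>u / v\<close>; it is used near the constant density.\<close>

lemma Bregman_le_square:
  fixes u v :: real
  assumes "0 < u" "0 < v"
  shows "u * (v / u - 1 - ln (v / u)) \<le> (v - u)\<^sup>2 / v"
proof -
  have "ln (u / v) \<le> u / v - 1"
    using assms by (intro ln_le_minus_one) auto
  then have "u * (v / u - 1 - ln (v / u)) \<le> u * (v / u - 1 + (u / v - 1))"
    using assms by (intro mult_left_mono) (auto simp: ln_div)
  also have "\<dots> = (v - u)\<^sup>2 / v"
    using assms by (simp add: field_simps power2_eq_square)
  finally show ?thesis .
qed

lemma Bregman_nonneg: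
  fixes u v :: real
  assumes "0 < u" "0 < v"
  shows "0 \<le> u * (v / u - 1 - ln (v / u))"
  by (rule order_trans[OF zero_le_power2 hellinger_le_Bregman[OF assms]])

section \<open>Energy functionals of a generator on a finite set\<close>

definition entropy_production ::
    "'a set \<Rightarrow> ('a \<Rightarrow> 'a \<Rightarrow> real) \<Rightarrow> ('a \<Rightarrow> real) \<Rightarrow> ('a \<Rightarrow> real) \<Rightarrow> real" where
  "entropy_production A K \<zeta> \<phi> =
     (\<Sum>z\<in>A. \<Sum>z'\<in>A. K z z' * \<zeta> z * \<phi> z * (\<phi> z' / \<phi> z - 1 - ln (\<phi> z' / \<phi> z)))"

text \<open>Twice the Dirichlet form of the symmetrisation of \<open>K\<close>, written with
  \<open>K\<close> itself; the factor 1/2 of the Poincare quotient is left out.\<close>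

definition square_energy ::
    "'a set \<Rightarrow> ('a \<Rightarrow> 'a \<Rightarrow> real) \<Rightarrow> ('a \<Rightarrow> real) \<Rightarrow> ('a \<Rightarrow> real) \<Rightarrow> real" where
  "square_energy A K \<zeta> f = (\<Sum>z\<in>A. \<Sum>z'\<in>A. K z z' * \<zeta> z * (f z - f z')\<^sup>2)"

lemma square_energy_nonneg:
  assumes "generator_on A K" "\<zeta> \<in> pos_prob_on A"
  shows "0 \<le> square_energy A K \<zeta> f"
  unfolding square_energy_def
proof (intro sum_nonneg)
  fix z z' assume z: "z \<in> A" "z' \<in> A"
  have "K z z' * 0 \<le> K z z' * (\<zeta> z * (f z - f z')\<^sup>2)"
    using assms z by (intro offdiag_mult_mono) (auto simp: pos_prob_on_def)
  then show "0 \<le> K z z' * \<zeta> z * (f z - f z')\<^sup>2" by (simp add: mult.assoc)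
qed

text \<open>The squared difference is symmetric in the pair and zero on the diagonal, so averaging
  the weights with their transpose leaves the double sum unchanged.\<close>

lemma symmetrised_square_energy:
  assumes "\<zeta> \<in> pos_prob_on A"
  shows "square_energy A (symmetrised_generator A \<zeta> K) \<zeta> f = square_energy A K \<zeta> f"
proof -
  have "square_energy A (symmetrised_generator A \<zeta> K) \<zeta> f =
    (\<Sum>z\<in>A. \<Sum>z'\<in>A. K z z' * \<zeta> z * (f z - f z')\<^sup>2 / 2 + K z' z * \<zeta> z' * (f z' - f z)\<^sup>2 / 2)"
    unfolding square_energy_def
  proof (intro sum.cong refl)
    fix z z' assume z: "z \<in> A" "z' \<in> A"
    then have "\<zeta> z \<noteq> 0" using assms by (auto simp: pos_prob_on_def)
    then have "symmetrised_generator A \<zeta> K z z' * \<zeta> z = (K z z' * \<zeta> z + K z' z * \<zeta> z') / 2" if "z \<noteq> z'"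
      using that by (simp add: symmetrised_generator_def restricted_generator_def field_simps)
    then have "symmetrised_generator A \<zeta> K z z' * \<zeta> z * (f z - f z')\<^sup>2 =
      (K z z' * \<zeta> z + K z' z * \<zeta> z') / 2 * (f z - f z')\<^sup>2"
      by (cases "z = z'") simp_all
    then show "symmetrised_generator A \<zeta> K z z' * \<zeta> z * (f z - f z')\<^sup>2 =
      K z z' * \<zeta> z * (f z - f z')\<^sup>2 / 2 + K z' z * \<zeta> z' * (f z' - f z)\<^sup>2 / 2"
      by (simp add: power2_commute[of "f z'"] distrib_right add_divide_distrib)
  qed
  also have "\<dots> = square_energy A K \<zeta> f / 2 + square_energy A K \<zeta> f / 2"
    unfolding square_energy_def sum.distrib
    by (subst (3) sum.swap) (simp add: sum_divide_distrib)
  finally show ?thesis by simp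
qed

text \<open>The added \<open>1 - \<phi> z\<close> has mean 0 under \<open>\<zeta>\<close> and makes
  every summand nonnegative, so that pointwise bounds apply.\<close>

lemma rel_entropy_centred:
  assumes "\<zeta> \<in> pos_prob_on A" "(\<Sum>z\<in>A. \<phi> z * \<zeta> z) = 1"
  shows "rel_entropy A \<zeta> \<phi> = (\<Sum>z\<in>A. (\<phi> z * ln (\<phi> z) - \<phi> z + 1) * \<zeta> z)"
  using assms by (simp add: rel_entropy_def pos_prob_on_def prob_on_def algebra_simps
      sum.distrib sum_subtractf)

lemma rel_entropy_nonneg:
  assumes "\<zeta> \<in> pos_prob_on A" "(\<Sum>z\<in>A. \<phi> z * \<zeta> z) = 1" "\<And>z. z \<in> A \<Longrightarrow> 0 < \<phi> z"
  shows "0 \<le> rel_entropy A \<zeta> \<phi>"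
  unfolding rel_entropy_centred[OF assms(1,2)]
proof (intro sum_nonneg mult_nonneg_nonneg)
  fix z assume "z \<in> A"
  then show "0 \<le> \<phi> z * ln (\<phi> z) - \<phi> z + 1"
    using order_trans[OF zero_le_power2 mult_ln_ge_hellinger[of "\<phi> z"]] assms(3) by simp
  show "0 \<le> \<zeta> z" using \<open>z \<in> A\<close> assms(1) by (auto simp: pos_prob_on_def prob_on_def)
qed

lemma rel_entropy_pos:
  assumes "finite A" "\<zeta> \<in> pos_prob_on A" "(\<Sum>z\<in>A. \<phi> z * \<zeta> z) = 1"
    and "\<And>z. z \<in> A \<Longrightarrow> 0 < \<phi> z" "x \<in> A" "\<phi> x \<noteq> 1"
  shows "0 < rel_entropy A \<zeta> \<phi>"
  unfolding rel_entropy_centred[OF assms(2,3)]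
proof (rule sum_pos2[OF assms(1,5)])
  have "0 < (sqrt (\<phi> x) - 1)\<^sup>2" using assms(6) by simp
  also have "\<dots> \<le> \<phi> x * ln (\<phi> x) - \<phi> x + 1"
    using assms by (intro mult_ln_ge_hellinger) auto
  finally show "0 < (\<phi> x * ln (\<phi> x) - \<phi> x + 1) * \<zeta> x"
    using assms by (auto simp: pos_prob_on_def)
  fix z assume z: "z \<in> A"
  then have "0 \<le> \<phi> z * ln (\<phi> z) - \<phi> z + 1"
    using order_trans[OF zero_le_power2 mult_ln_ge_hellinger[of "\<phi> z"]] assms(4) by simp
  then show "0 \<le> (\<phi> z * ln (\<phi> z) - \<phi> z + 1) * \<zeta> z"
    using z assms(2) by (auto simp: pos_prob_on_def prob_on_def)
qed

lemma entropy_production_ge_energy: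
  assumes "generator_on A K" "\<zeta> \<in> pos_prob_on A" "\<And>z. z \<in> A \<Longrightarrow> 0 < \<phi> z"
  shows "square_energy A K \<zeta> (\<lambda>z. sqrt (\<phi> z)) \<le> entropy_production A K \<zeta> \<phi>"
  unfolding square_energy_def entropy_production_def
proof (intro sum_mono)
  fix z z' assume z: "z \<in> A" "z' \<in> A"
  have "K z z' * (\<zeta> z * (sqrt (\<phi> z) - sqrt (\<phi> z'))\<^sup>2)
    \<le> K z z' * (\<zeta> z * (\<phi> z * (\<phi> z' / \<phi> z - 1 - ln (\<phi> z' / \<phi> z))))"
  proof (rule offdiag_mult_mono[OF assms(1) z])
    show "\<zeta> z * (sqrt (\<phi> z) - sqrt (\<phi> z'))\<^sup>2
        \<le> \<zeta> z * (\<phi> z * (\<phi> z' / \<phi> z - 1 - ln (\<phi> z' / \<phi> z)))"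
      using hellinger_le_Bregman[of "\<phi> z" "\<phi> z'"] assms z
      by (intro mult_left_mono) (auto simp: pos_prob_on_def prob_on_def power2_commute)
  qed (use assms(3)[OF z(1)] in auto)
  then show "K z z' * \<zeta> z * (sqrt (\<phi> z) - sqrt (\<phi> z'))\<^sup>2
    \<le> K z z' * \<zeta> z * \<phi> z * (\<phi> z' / \<phi> z - 1 - ln (\<phi> z' / \<phi> z))"
    by (simp add: mult.assoc)
qed

lemma entropy_production_nonneg:
  assumes "generator_on A K" "\<zeta> \<in> pos_prob_on A" "\<And>z. z \<in> A \<Longrightarrow> 0 < \<phi> z"
  shows "0 \<le> entropy_production A K \<zeta> \<phi>"
  by (rule order_trans[OF square_energy_nonneg[OF assms(1,2)] entropy_production_ge_energy[OF assms]])

text \<open>A real lower bound \<open>a\<close> is used because \<open>gLSI\<close> can be infinite.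
  The constant density 1 is excluded from the infimum; it falls under the case of zero entropy,
  where nonnegative production suffices.\<close>

lemma gLSI_le_entropy_production:
  fixes a :: real
  assumes "generator_on A K" "\<zeta> \<in> pos_prob_on A" "ereal a \<le> gLSI A \<zeta> K"
    and \<phi>: "\<And>z. z \<in> A \<Longrightarrow> 0 < \<phi> z" "(\<Sum>z\<in>A. \<phi> z * \<zeta> z) = 1"
  shows "a * rel_entropy A \<zeta> \<phi> \<le> entropy_production A K \<zeta> \<phi>"
proof (cases "rel_entropy A \<zeta> \<phi> = 0")
  case True
  then show ?thesis using entropy_production_nonneg[of A K \<zeta> \<phi>] assms by simp
next
  case False
  then have "0 < rel_entropy A \<zeta> \<phi>" using rel_entropy_nonneg[of \<zeta> A \<phi>] assms by force
  moreover have "\<exists>z\<in>A. \<phi> z \<noteq> 1"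
    using False unfolding rel_entropy_def by (metis (no_types, lifting) ln_one mult_eq_0_iff sum.neutral)
  then have "gLSI A \<zeta> K \<le> ereal (entropy_production A K \<zeta> \<phi> / rel_entropy A \<zeta> \<phi>)"
    unfolding gLSI_def entropy_production_def using \<phi> by (intro INF_lower) auto
  then have "a \<le> entropy_production A K \<zeta> \<phi> / rel_entropy A \<zeta> \<phi>"
    using assms(3) by (metis ereal_less_eq(3) order_trans)
  ultimately show ?thesis by (simp add: field_simps)
qed

section \<open>Poincare and log-Sobolev constants\<close>

lemma variance_on_nonneg:
  assumes "\<zeta> \<in> pos_prob_on A"
  shows "0 \<le> variance_on A \<zeta> f"
  using assms unfolding variance_on_def pos_prob_on_def prob_on_def by (auto intro!: sum_nonneg)

lemma variance_on_eq:
  assumes "\<zeta> \<in> pos_prob_on A"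
  shows "variance_on A \<zeta> f = (\<Sum>z\<in>A. (f z)\<^sup>2 * \<zeta> z) - (\<Sum>z\<in>A. f z * \<zeta> z)\<^sup>2"
proof -
  define m where "m = (\<Sum>z\<in>A. f z * \<zeta> z)"
  have "variance_on A \<zeta> f = (\<Sum>z\<in>A. (f z)\<^sup>2 * \<zeta> z - 2 * m * (f z * \<zeta> z) + m\<^sup>2 * \<zeta> z)"
    unfolding variance_on_def m_def[symmetric]
    by (intro sum.cong refl) (simp add: power2_eq_square algebra_simps)
  also have "\<dots> = (\<Sum>z\<in>A. (f z)\<^sup>2 * \<zeta> z) - 2 * m * m + m\<^sup>2 * (\<Sum>z\<in>A. \<zeta> z)"
    by (simp add: sum.distrib sum_subtractf sum_distrib_left m_def)
  finally show ?thesis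
    using assms by (simp add: m_def pos_prob_on_def prob_on_def power2_eq_square)
qed

lemma pos_prob_on_le_one:
  assumes "finite A" "\<zeta> \<in> pos_prob_on A" "z \<in> A"
  shows "\<zeta> z \<le> 1"
proof -
  have "\<zeta> z \<le> (\<Sum>z\<in>A. \<zeta> z)"
    using assms by (intro member_le_sum) (auto simp: pos_prob_on_def prob_on_def)
  then show ?thesis using assms by (simp add: pos_prob_on_def prob_on_def)
qed

lemma ln_inverse_min_nonneg:
  assumes "finite A" "\<zeta> \<in> pos_prob_on A" "A \<noteq> {}"
  shows "0 \<le> ln (1 / (MIN x\<in>A. \<zeta> x))"
proof -
  obtain z where z: "z \<in> A" using assms by auto
  have "(MIN x\<in>A. \<zeta> x) \<le> \<zeta> z" using z assms by simp
  also have "\<dots> \<le> 1" using pos_prob_on_le_one[OF assms(1,2) z] .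
  finally have "(MIN x\<in>A. \<zeta> x) \<le> 1" .
  moreover have "0 < (MIN x\<in>A. \<zeta> x)" using assms by (simp add: pos_prob_on_def)
  ultimately show ?thesis by simp
qed

text \<open>Mean 1 forces \<open>\<phi> \<le> 1 / min \<zeta>\<close>, so
  \<open>mult_ln_le_hellinger\<close> applies with \<open>L = ln (1 / min \<zeta>)\<close>. If
  \<open>m\<close> is the mean of the root of \<open>\<phi>\<close>, the squared distance of that
  root from 1 has mean \<open>2 * (1 - m)\<close>, at most twice the variance
  \<open>1 - m\<^sup>2\<close> because \<open>m\<close> lies in [0,1].\<close>

lemma rel_entropy_le_variance_sqrt:
  assumes "finite A" "\<zeta> \<in> pos_prob_on A" "(\<Sum>z\<in>A. \<phi> z * \<zeta> z) = 1"
    and pos: "\<And>z. z \<in> A \<Longrightarrow> 0 < \<phi> z" and "A \<noteq> {}"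
  shows "rel_entropy A \<zeta> \<phi> \<le>
    2 * (2 + ln (1 / (MIN x\<in>A. \<zeta> x))) * variance_on A \<zeta> (\<lambda>z. sqrt (\<phi> z))"
proof -
  define L where "L = ln (1 / (MIN x\<in>A. \<zeta> x))"
  define m where "m = (\<Sum>z\<in>A. sqrt (\<phi> z) * \<zeta> z)"
  have \<zeta>: "\<And>z. z \<in> A \<Longrightarrow> 0 < \<zeta> z" "(\<Sum>z\<in>A. \<zeta> z) = 1"
    using assms by (auto simp: pos_prob_on_def prob_on_def)
  have Minpos: "0 < (MIN x\<in>A. \<zeta> x)" using assms \<zeta> by simp
  have L: "ln (\<phi> z) \<le> L" if "z \<in> A" for z
  proof -
    have "\<phi> z * (MIN x\<in>A. \<zeta> x) \<le> \<phi> z * \<zeta> z"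
      using that pos[OF that] assms(1) by (intro mult_left_mono) (auto simp: less_imp_le)
    also have "\<dots> \<le> (\<Sum>z\<in>A. \<phi> z * \<zeta> z)"
      using that pos \<zeta> assms(1) by (intro member_le_sum[of z A "\<lambda>z. \<phi> z * \<zeta> z"]) (auto simp: less_imp_le)
    finally have "\<phi> z \<le> 1 / (MIN x\<in>A. \<zeta> x)"
      using Minpos by (simp add: assms(3) pos_le_divide_eq)
    then show ?thesis
      unfolding L_def using pos[OF that] Minpos by (intro ln_mono) auto
  qed
  have "0 \<le> L" unfolding L_def using ln_inverse_min_nonneg assms by blast
  have var: "variance_on A \<zeta> (\<lambda>z. sqrt (\<phi> z)) = 1 - m\<^sup>2"
    unfolding variance_on_eq[OF assms(2)] m_def assms(3)[symmetric]
    using pos by (simp add: less_imp_le cong: sum.cong)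
  have "0 \<le> m" unfolding m_def using pos \<zeta> by (auto intro!: sum_nonneg simp: less_imp_le)
  have "m\<^sup>2 \<le> 1" using variance_on_nonneg[OF assms(2), of "\<lambda>z. sqrt (\<phi> z)"] var by simp
  then have "m \<le> 1" by (metis abs_le_D1 abs_square_le_1)
  have "rel_entropy A \<zeta> \<phi> \<le> (\<Sum>z\<in>A. ((2 + L) * (sqrt (\<phi> z) - 1)\<^sup>2) * \<zeta> z)"
    unfolding rel_entropy_centred[OF assms(2,3)]
  proof (intro sum_mono mult_right_mono)
    fix z assume z: "z \<in> A"
    show "\<phi> z * ln (\<phi> z) - \<phi> z + 1 \<le> (2 + L) * (sqrt (\<phi> z) - 1)\<^sup>2"
      using mult_ln_le_hellinger[of "sqrt (\<phi> z)" L] L[OF z] pos[OF z] \<open>0 \<le> L\<close>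
      by (simp add: ln_sqrt)
  qed (use \<zeta> in \<open>auto simp: less_imp_le\<close>)
  also have "\<dots> = (2 + L) * (\<Sum>z\<in>A. \<phi> z * \<zeta> z - 2 * (sqrt (\<phi> z) * \<zeta> z) + \<zeta> z)"
    unfolding sum_distrib_left
  proof (intro sum.cong refl)
    fix z assume z: "z \<in> A"
    have "(sqrt (\<phi> z) - 1)\<^sup>2 = \<phi> z - 2 * sqrt (\<phi> z) + 1"
      using pos[OF z] by (simp add: power2_diff)
    then have "(sqrt (\<phi> z) - 1)\<^sup>2 * \<zeta> z = \<phi> z * \<zeta> z - 2 * (sqrt (\<phi> z) * \<zeta> z) + \<zeta> z"
      by (simp add: distrib_right left_diff_distrib)
    then show "((2 + L) * (sqrt (\<phi> z) - 1)\<^sup>2) * \<zeta> z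
      = (2 + L) * (\<phi> z * \<zeta> z - 2 * (sqrt (\<phi> z) * \<zeta> z) + \<zeta> z)"
      by (simp only: mult.assoc)
  qed
  also have "\<dots> = (2 + L) * (2 * (1 - m))"
    by (simp add: sum.distrib sum_subtractf assms(3) \<zeta>(2) m_def flip: sum_distrib_left)
  also have "\<dots> \<le> (2 + L) * (2 * (1 - m\<^sup>2))"
    using \<open>0 \<le> L\<close> \<open>0 \<le> m\<close> \<open>m \<le> 1\<close>
    by (intro mult_left_mono) (auto simp: power2_eq_square mult_left_le)
  also have "\<dots> = 2 * (2 + L) * variance_on A \<zeta> (\<lambda>z. sqrt (\<phi> z))"
    by (simp only: var mult_ac)
  finally show ?thesis unfolding L_def .
qed

lemma poincare_constant_symmetrised:
  assumes "\<zeta> \<in> pos_prob_on A"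
  shows "poincare_constant A \<zeta> (symmetrised_generator A \<zeta> K) =
    (INF f\<in>{f. \<exists>x\<in>A. \<exists>x'\<in>A. f x \<noteq> f x'}.
       ereal (square_energy A K \<zeta> f / 2 / variance_on A \<zeta> f))"
  unfolding poincare_constant_def
  using symmetrised_square_energy[OF assms, of K] by (simp add: square_energy_def)

lemma poincare_constant_symmetrised_nonneg:
  assumes "generator_on A K" "\<zeta> \<in> pos_prob_on A"
  shows "0 \<le> poincare_constant A \<zeta> (symmetrised_generator A \<zeta> K)"
  unfolding poincare_constant_symmetrised[OF assms(2)]
  using square_energy_nonneg[OF assms] variance_on_nonneg[OF assms(2)]
  by (intro INF_greatest) simp

text \<open>The Poincare inequality is tested with the square root of the density. Production is at
  least the energy \<open>E\<close> of the root and entropy is at most \<open>2 * c * V\<close>;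
  this 2 matches the 1/2 in the Poincare quotient.\<close>

lemma poincare_le_gLSI:
  assumes "finite A" "A \<noteq> {}" "generator_on A K" "\<zeta> \<in> pos_prob_on A"
  shows "poincare_constant A \<zeta> (symmetrised_generator A \<zeta> K)
    / ereal (2 + ln (1 / (MIN x\<in>A. \<zeta> x))) \<le> gLSI A \<zeta> K"
  unfolding gLSI_def entropy_production_def[symmetric]
proof (rule INF_greatest, clarify)
  fix \<phi> x assume pos: "\<forall>z\<in>A. 0 < \<phi> z" and mean: "(\<Sum>z\<in>A. \<phi> z * \<zeta> z) = 1"
    and x: "x \<in> A" "\<phi> x \<noteq> 1"
  define c where "c = 2 + ln (1 / (MIN x\<in>A. \<zeta> x))"
  define E where "E = square_energy A K \<zeta> (\<lambda>z. sqrt (\<phi> z))"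
  define V where "V = variance_on A \<zeta> (\<lambda>z. sqrt (\<phi> z))"
  have "0 < c" using ln_inverse_min_nonneg[OF assms(1,4,2)] by (simp add: c_def)
  \<comment> \<open>A constant density of mean 1 would be identically 1, so the root is an
    admissible test function.\<close>
  have "\<exists>z\<in>A. sqrt (\<phi> x) \<noteq> sqrt (\<phi> z)"
  proof (rule ccontr)
    assume "\<not> ?thesis"
    then have "\<forall>z\<in>A. \<phi> z = \<phi> x" by simp
    then have "(\<Sum>z\<in>A. \<phi> z * \<zeta> z) = \<phi> x * (\<Sum>z\<in>A. \<zeta> z)"
      by (simp add: sum_distrib_left)
    then show False using mean x assms by (simp add: pos_prob_on_def prob_on_def)
  qed
  then have "poincare_constant A \<zeta> (symmetrised_generator A \<zeta> K) \<le> ereal (E / 2 / V)"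
    unfolding poincare_constant_symmetrised[OF assms(4)] E_def V_def
    using x(1) by (intro INF_lower) auto
  then have "poincare_constant A \<zeta> (symmetrised_generator A \<zeta> K) / ereal c \<le> ereal (E / 2 / V) / ereal c"
    using \<open>0 < c\<close> by (intro ereal_divide_right_mono) auto
  also have "\<dots> = ereal (E / 2 / V / c)" using \<open>0 < c\<close> by simp
  also have "\<dots> \<le> ereal (entropy_production A K \<zeta> \<phi> / rel_entropy A \<zeta> \<phi>)"
  proof -
    have H: "0 < rel_entropy A \<zeta> \<phi>"
      using rel_entropy_pos[of A \<zeta> \<phi> x] assms pos mean x by auto
    moreover have "rel_entropy A \<zeta> \<phi> \<le> 2 * c * V"
      unfolding c_def V_def using rel_entropy_le_variance_sqrt[of A \<zeta> \<phi>] assms pos mean by auto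
    moreover have "E \<le> entropy_production A K \<zeta> \<phi>"
      unfolding E_def using entropy_production_ge_energy assms pos by blast
    moreover have "0 \<le> E" unfolding E_def by (rule square_energy_nonneg[OF assms(3,4)])
    ultimately have "E / (2 * c * V) \<le> entropy_production A K \<zeta> \<phi> / rel_entropy A \<zeta> \<phi>"
      by (intro frac_le) auto
    then show ?thesis by (simp add: mult_ac)
  qed
  finally show "poincare_constant A \<zeta> (symmetrised_generator A \<zeta> K)
    / ereal (2 + ln (1 / (MIN x\<in>A. \<zeta> x)))
    \<le> ereal (entropy_production A K \<zeta> \<phi> / rel_entropy A \<zeta> \<phi>)" by (simp add: c_def)
qed

section \<open>Positive Poincare constant of an irreducible chain\<close>

lemma variance_on_le_sum_differences:
  assumes "finite A" "\<zeta> \<in> pos_prob_on A"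
  shows "variance_on A \<zeta> f \<le> (\<Sum>x\<in>A. \<Sum>z\<in>A. (f x - f z)\<^sup>2)"
proof -
  have \<zeta>: "(\<Sum>z\<in>A. \<zeta> z) = 1"
    using assms by (auto simp: pos_prob_on_def prob_on_def)
  have "variance_on A \<zeta> f \<le> (\<Sum>x\<in>A. (f x - (\<Sum>z\<in>A. f z * \<zeta> z))\<^sup>2 * 1)"
    unfolding variance_on_def
    using pos_prob_on_le_one[OF assms] by (intro sum_mono mult_left_mono) auto
  also have "\<dots> \<le> (\<Sum>x\<in>A. \<Sum>z\<in>A. (f x - f z)\<^sup>2)"
  proof (rule sum_mono)
    fix x assume "x \<in> A"
    \<comment> \<open>Jensen's inequality for the square, read off from a nonnegative
      variance.\<close>
    have "0 \<le> variance_on A \<zeta> (\<lambda>z. f x - f z)" by (rule variance_on_nonneg[OF assms(2)])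
    then have "(\<Sum>z\<in>A. (f x - f z) * \<zeta> z)\<^sup>2 \<le> (\<Sum>z\<in>A. (f x - f z)\<^sup>2 * \<zeta> z)"
      by (simp add: variance_on_eq[OF assms(2)])
    also have "\<dots> \<le> (\<Sum>z\<in>A. (f x - f z)\<^sup>2 * 1)"
      using pos_prob_on_le_one[OF assms] by (intro sum_mono mult_left_mono) auto
    also have "(\<Sum>z\<in>A. (f x - f z) * \<zeta> z) = f x - (\<Sum>z\<in>A. f z * \<zeta> z)"
      by (simp add: left_diff_distrib sum_subtractf \<zeta> flip: sum_distrib_left)
    finally show "(f x - (\<Sum>z\<in>A. f z * \<zeta> z))\<^sup>2 * 1 \<le> (\<Sum>z\<in>A. (f x - f z)\<^sup>2)" by simp
  qed
  finally show ?thesis .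
qed

lemma variance_on_pos:
  assumes "finite A" "\<zeta> \<in> pos_prob_on A" "x \<in> A" "x' \<in> A" "f x \<noteq> f x'"
  shows "0 < variance_on A \<zeta> f"
proof -
  define m where "m = (\<Sum>z\<in>A. f z * \<zeta> z)"
  obtain z where z: "z \<in> A" "f z \<noteq> m" using assms(3-5) by metis
  have "0 < (f z - m)\<^sup>2 * \<zeta> z"
    using z assms(2) by (auto simp: pos_prob_on_def)
  then show ?thesis
    unfolding variance_on_def m_def[symmetric]
    using assms by (intro sum_pos2[OF assms(1) z(1)]) (auto simp: pos_prob_on_def prob_on_def)
qed

lemma edge_le_square_energy:
  assumes "finite A" "generator_on A K" "\<zeta> \<in> pos_prob_on A" "u \<in> A" "v \<in> A"
  shows "K u v * \<zeta> u * (f u - f v)\<^sup>2 \<le> square_energy A K \<zeta> f"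
proof -
  have nn: "0 \<le> K z z' * \<zeta> z * (f z - f z')\<^sup>2" if "z \<in> A" "z' \<in> A" for z z'
    using offdiag_mult_mono[OF assms(2) that, of 0 "\<zeta> z * (f z - f z')\<^sup>2"] assms(3) that(1)
    by (simp add: mult.assoc pos_prob_on_def prob_on_def)
  have "K u v * \<zeta> u * (f u - f v)\<^sup>2 \<le> (\<Sum>z'\<in>A. K u z' * \<zeta> u * (f u - f z')\<^sup>2)"
    using assms nn by (intro member_le_sum[of v A "\<lambda>z'. K u z' * \<zeta> u * (f u - f z')\<^sup>2"]) auto
  also have "\<dots> \<le> square_energy A K \<zeta> f"
    unfolding square_energy_def using assms nn
    by (intro member_le_sum[of u A "\<lambda>z. \<Sum>z'\<in>A. K z z' * \<zeta> z * (f z - f z')\<^sup>2"] sum_nonneg) auto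
  finally show ?thesis .
qed

text \<open>Induction along a path of edges with positive rates: each edge difference is controlled
  by its own term of the energy. The constant depends on the path and not on
  \<open>f\<close>.\<close>

lemma path_le_square_energy:
  assumes "finite A" "generator_on A K" "\<zeta> \<in> pos_prob_on A"
    and "(x, x') \<in> {(u, v). u \<in> A \<and> v \<in> A \<and> 0 < K u v}\<^sup>*"
  shows "\<exists>C\<ge>0. \<forall>f. (f x - f x')\<^sup>2 \<le> C * square_energy A K \<zeta> f"
  using assms(4)
proof induction
  case base
  show ?case by (intro exI[of _ 0]) simp
next
  case (step v w)
  then obtain C where C: "0 \<le> C" "\<And>f. (f x - f v)\<^sup>2 \<le> C * square_energy A K \<zeta> f" by blast
  have vw: "v \<in> A" "w \<in> A" "0 < K v w" using step by auto
  then have pos: "0 < K v w * \<zeta> v" using assms(3) by (simp add: pos_prob_on_def)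
  have "(f x - f w)\<^sup>2 \<le> (2 * C + 2 / (K v w * \<zeta> v)) * square_energy A K \<zeta> f" for f
  proof -
    \<comment> \<open>Expanding this square gives
      \<open>(a + b)\<^sup>2 \<le> 2 * a\<^sup>2 + 2 * b\<^sup>2\<close>.\<close>
    have "0 \<le> ((f x - f v) - (f v - f w))\<^sup>2" by simp
    then have "(f x - f w)\<^sup>2 \<le> 2 * (f x - f v)\<^sup>2 + 2 * (f v - f w)\<^sup>2"
      by (simp add: power2_eq_square algebra_simps)
    moreover have "(f v - f w)\<^sup>2 \<le> square_energy A K \<zeta> f / (K v w * \<zeta> v)"
      using edge_le_square_energy[OF assms(1-3) vw(1,2), of f] pos
      by (simp add: pos_le_divide_eq mult.commute)
    ultimately show ?thesis using C(2)[of f] by (simp add: distrib_right)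
  qed
  then show ?case using C(1) pos
    by (intro exI[of _ "2 * C + 2 / (K v w * \<zeta> v)"]) (auto simp: less_imp_le)
qed

lemma poincare_constant_pos_of_irreducible:
  assumes "finite A" "generator_on A K" "irreducible_on A K" "\<zeta> \<in> pos_prob_on A"
  shows "0 < poincare_constant A \<zeta> (symmetrised_generator A \<zeta> K)"
proof -
  have "\<forall>x\<in>A. \<forall>x'\<in>A. \<exists>C\<ge>0. \<forall>f. (f x - f x')\<^sup>2 \<le> C * square_energy A K \<zeta> f"
    using assms path_le_square_energy[OF assms(1,2,4)] unfolding irreducible_on_def by blast
  then obtain C where C: "\<And>x x'. x \<in> A \<Longrightarrow> x' \<in> A \<Longrightarrow> 0 \<le> C x x'"
    "\<And>x x' f. x \<in> A \<Longrightarrow> x' \<in> A \<Longrightarrow> (f x - f x')\<^sup>2 \<le> C x x' * square_energy A K \<zeta> f"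
    by metis
  \<comment> \<open>The summed path constants bound the variance by the energy. The extra 1 makes
    \<open>D\<close> positive, and \<open>1 / (2 * D)\<close> is then a lower bound for the Poincare
    quotient.\<close>
  define D where "D = 1 + (\<Sum>x\<in>A. \<Sum>x'\<in>A. C x x')"
  have "1 \<le> D" unfolding D_def using C(1) by (simp add: sum_nonneg)
  have var: "variance_on A \<zeta> f \<le> D * square_energy A K \<zeta> f" for f
  proof -
    have "variance_on A \<zeta> f \<le> (\<Sum>x\<in>A. \<Sum>z\<in>A. (f x - f z)\<^sup>2)"
      by (rule variance_on_le_sum_differences[OF assms(1,4)])
    also have "\<dots> \<le> (\<Sum>x\<in>A. \<Sum>z\<in>A. C x z * square_energy A K \<zeta> f)"
      using C(2) by (intro sum_mono)
    also have "\<dots> \<le> D * square_energy A K \<zeta> f"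
      unfolding D_def using square_energy_nonneg[OF assms(2,4), of f]
      by (simp add: distrib_right sum_distrib_right)
    finally show ?thesis .
  qed
  have "0 < ereal (1 / (2 * D))" using \<open>1 \<le> D\<close> by simp
  also have "\<dots> \<le> poincare_constant A \<zeta> (symmetrised_generator A \<zeta> K)"
    unfolding poincare_constant_symmetrised[OF assms(4)]
  proof (rule INF_greatest, clarify)
    fix f :: "'a \<Rightarrow> real" and x x' assume x: "x \<in> A" "x' \<in> A" "f x \<noteq> f x'"
    have "0 < variance_on A \<zeta> f" using variance_on_pos[OF assms(1,4) x] .
    then show "ereal (1 / (2 * D)) \<le> ereal (square_energy A K \<zeta> f / 2 / variance_on A \<zeta> f)"
      using var[of f] \<open>1 \<le> D\<close> by (simp add: field_simps)
  qed
  finally show ?thesis .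
qed

text \<open>
  Testing the log-Sobolev inequality with densities between 1/2 and 4 close to the constant 1
  recovers a Poincare inequality without a limiting argument.
\<close>

lemma variance_on_le_rel_entropy:
  assumes "\<zeta> \<in> pos_prob_on A" "(\<Sum>z\<in>A. \<phi> z * \<zeta> z) = 1"
    and \<phi>: "\<And>z. z \<in> A \<Longrightarrow> 0 < \<phi> z" "\<And>z. z \<in> A \<Longrightarrow> \<phi> z \<le> 4"
  shows "variance_on A \<zeta> \<phi> \<le> 9 * rel_entropy A \<zeta> \<phi>"
  unfolding rel_entropy_centred[OF assms(1,2)] variance_on_def assms(2) sum_distrib_left
proof (rule sum_mono)
  fix z assume z: "z \<in> A"
  \<comment> \<open>The factor 9 arises here: \<open>\<phi> z \<le> 4\<close> gives
    \<open>sqrt (\<phi> z) + 1 \<le> 3\<close>.\<close>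
  have "(\<phi> z - 1)\<^sup>2 = (sqrt (\<phi> z) + 1)\<^sup>2 * (sqrt (\<phi> z) - 1)\<^sup>2"
    using \<phi>(1)[OF z] by (simp add: algebra_simps flip: power_mult_distrib)
  also have "\<dots> \<le> 3\<^sup>2 * (sqrt (\<phi> z) - 1)\<^sup>2"
  proof (intro mult_right_mono power_mono)
    have "sqrt (\<phi> z) \<le> sqrt (2\<^sup>2)" using \<phi>(2)[OF z] by (intro real_sqrt_le_mono) simp
    then show "sqrt (\<phi> z) + 1 \<le> 3" by simp
  qed (use \<phi>(1)[OF z] in auto)
  also have "\<dots> \<le> 9 * (\<phi> z * ln (\<phi> z) - \<phi> z + 1)"
    using mult_ln_ge_hellinger[OF \<phi>(1)[OF z]] by simp
  finally have "(\<phi> z - 1)\<^sup>2 * \<zeta> z \<le> 9 * (\<phi> z * ln (\<phi> z) - \<phi> z + 1) * \<zeta> z"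
    using assms(1) z by (intro mult_right_mono) (auto simp: pos_prob_on_def prob_on_def)
  then show "(\<phi> z - 1)\<^sup>2 * \<zeta> z \<le> 9 * ((\<phi> z * ln (\<phi> z) - \<phi> z + 1) * \<zeta> z)" by (simp only: mult.assoc)
qed

lemma entropy_production_le_energy:
  assumes "generator_on A K" "\<zeta> \<in> pos_prob_on A" "\<And>z. z \<in> A \<Longrightarrow> 1 / 2 \<le> \<phi> z"
  shows "entropy_production A K \<zeta> \<phi> \<le> 2 * square_energy A K \<zeta> \<phi>"
  unfolding square_energy_def entropy_production_def sum_distrib_left
proof (intro sum_mono)
  fix z z' assume z: "z \<in> A" "z' \<in> A"
  have pos: "0 < \<phi> z" "0 < \<phi> z'" using assms(3)[OF z(1)] assms(3)[OF z(2)] by auto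
  have "\<phi> z * (\<phi> z' / \<phi> z - 1 - ln (\<phi> z' / \<phi> z)) \<le> (\<phi> z' - \<phi> z)\<^sup>2 / \<phi> z'"
    by (rule Bregman_le_square[OF pos])
  also have "\<dots> \<le> (\<phi> z' - \<phi> z)\<^sup>2 / (1 / 2)"
    using assms(3)[OF z(2)] pos by (intro divide_left_mono) auto
  finally have "\<phi> z * (\<phi> z' / \<phi> z - 1 - ln (\<phi> z' / \<phi> z)) \<le> 2 * (\<phi> z - \<phi> z')\<^sup>2"
    by (simp add: power2_commute)
  then have "K z z' * (\<zeta> z * (\<phi> z * (\<phi> z' / \<phi> z - 1 - ln (\<phi> z' / \<phi> z))))
    \<le> K z z' * (\<zeta> z * (2 * (\<phi> z - \<phi> z')\<^sup>2))"
    using assms(2) z pos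
    by (intro offdiag_mult_mono[OF assms(1) z] mult_left_mono) (auto simp: pos_prob_on_def prob_on_def)
  then show "K z z' * \<zeta> z * \<phi> z * (\<phi> z' / \<phi> z - 1 - ln (\<phi> z' / \<phi> z))
    \<le> 2 * (K z z' * \<zeta> z * (\<phi> z - \<phi> z')\<^sup>2)"
    by (simp add: mult_ac)
qed

text \<open>The test density is \<open>1 + \<epsilon> * (f - m)\<close>; variance and energy both
  scale with \<open>\<epsilon>\<^sup>2\<close>, which cancels. The 36 is 9 from comparing variance
  with entropy, 2 from comparing production with energy, and 2 from the half in the Poincare
  quotient.\<close>

lemma gLSI_le_poincare:
  assumes "finite A" "generator_on A K" "\<zeta> \<in> pos_prob_on A" and a: "0 \<le> a" "ereal a \<le> gLSI A \<zeta> K"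
  shows "ereal (a / 36) \<le> poincare_constant A \<zeta> (symmetrised_generator A \<zeta> K)"
  unfolding poincare_constant_symmetrised[OF assms(3)]
proof (rule INF_greatest, clarify)
  fix f :: "'a \<Rightarrow> real" and x x' assume x: "x \<in> A" "x' \<in> A" "f x \<noteq> f x'"
  define m where "m = (\<Sum>z\<in>A. f z * \<zeta> z)"
  \<comment> \<open>\<open>B\<close> dominates every deviation of \<open>f\<close> from its mean, so
    \<open>\<epsilon>\<close> keeps the perturbation within 1/2. The extra 1 avoids division by
    0.\<close>
  define B where "B = 1 + (\<Sum>z\<in>A. \<bar>f z - m\<bar>)"
  define \<epsilon> where "\<epsilon> = 1 / (2 * B)"
  define \<phi> where "\<phi> = (\<lambda>z. 1 + \<epsilon> * (f z - m))"
  have \<zeta>1: "(\<Sum>z\<in>A. \<zeta> z) = 1" using assms(3) by (simp add: pos_prob_on_def prob_on_def)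
  have "1 \<le> B" unfolding B_def by (simp add: sum_nonneg)
  then have "0 < \<epsilon>" by (simp add: \<epsilon>_def)
  have "\<bar>\<epsilon> * (f z - m)\<bar> \<le> 1 / 2" if "z \<in> A" for z
  proof -
    have "\<bar>f z - m\<bar> \<le> (\<Sum>z\<in>A. \<bar>f z - m\<bar>)"
      using that assms(1) by (intro member_le_sum[of z A "\<lambda>z. \<bar>f z - m\<bar>"]) auto
    then have "\<bar>f z - m\<bar> \<le> B" by (simp add: B_def)
    then show ?thesis using \<open>1 \<le> B\<close> by (simp add: \<epsilon>_def abs_mult field_simps)
  qed
  then have \<phi>: "1 / 2 \<le> \<phi> z" "\<phi> z \<le> 4" if "z \<in> A" for z
    using that by (fastforce simp: \<phi>_def abs_le_iff)+
  then have pos: "0 < \<phi> z" if "z \<in> A" for z using that by fastforce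
  have "(\<Sum>z\<in>A. \<phi> z * \<zeta> z) = (\<Sum>z\<in>A. \<zeta> z) + \<epsilon> * ((\<Sum>z\<in>A. f z * \<zeta> z) - m * (\<Sum>z\<in>A. \<zeta> z))"
    by (simp add: \<phi>_def algebra_simps sum.distrib sum_subtractf sum_distrib_left)
  then have mean: "(\<Sum>z\<in>A. \<phi> z * \<zeta> z) = 1" by (simp add: \<zeta>1 m_def)
  have V: "variance_on A \<zeta> \<phi> = \<epsilon>\<^sup>2 * variance_on A \<zeta> f"
    unfolding variance_on_def mean m_def[symmetric]
    by (simp add: \<phi>_def power_mult_distrib sum_distrib_left mult.assoc)
  have E: "square_energy A K \<zeta> \<phi> = \<epsilon>\<^sup>2 * square_energy A K \<zeta> f"
  proof -
    have "(\<phi> z - \<phi> z')\<^sup>2 = \<epsilon>\<^sup>2 * (f z - f z')\<^sup>2" for z z'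
      unfolding \<phi>_def by (simp add: algebra_simps flip: power_mult_distrib)
    then show ?thesis unfolding square_energy_def by (simp add: sum_distrib_left mult_ac)
  qed
  have "a * variance_on A \<zeta> \<phi> \<le> a * (9 * rel_entropy A \<zeta> \<phi>)"
    using variance_on_le_rel_entropy[OF assms(3) mean pos \<phi>(2)] a by (intro mult_left_mono) auto
  also have "\<dots> \<le> 9 * entropy_production A K \<zeta> \<phi>"
    using gLSI_le_entropy_production[OF assms(2,3) a(2) pos mean] by simp
  also have "\<dots> \<le> 18 * square_energy A K \<zeta> \<phi>"
    using entropy_production_le_energy[OF assms(2,3) \<phi>(1)] by simp
  finally have "\<epsilon>\<^sup>2 * (a * variance_on A \<zeta> f) \<le> \<epsilon>\<^sup>2 * (18 * square_energy A K \<zeta> f)"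
    by (simp add: V E mult_ac)
  then have "a * variance_on A \<zeta> f \<le> 18 * square_energy A K \<zeta> f"
    using \<open>0 < \<epsilon>\<close> by simp
  moreover have "0 < variance_on A \<zeta> f" using variance_on_pos[OF assms(1,3) x] .
  ultimately show "ereal (a / 36) \<le> ereal (square_energy A K \<zeta> f / 2 / variance_on A \<zeta> f)"
    by (simp add: field_simps)
qed

lemma poincare_constant_pos_of_gLSI_pos:
  assumes "finite A" "generator_on A K" "\<zeta> \<in> pos_prob_on A" "0 < gLSI A \<zeta> K"
  shows "0 < poincare_constant A \<zeta> (symmetrised_generator A \<zeta> K)"
proof -
  obtain a where a: "0 < ereal a" "ereal a < gLSI A \<zeta> K"
    using ereal_dense2[OF assms(4)] by auto
  then have "0 < ereal (a / 36)" by simp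
  also have "\<dots> \<le> poincare_constant A \<zeta> (symmetrised_generator A \<zeta> K)"
    using a by (intro gLSI_le_poincare[OF assms(1-3)]) auto
  finally show ?thesis .
qed

section \<open>Solutions of the Kolmogorov equation\<close>

text \<open>At time 0 only continuity is used; at interior times the one-sided derivative is a
  two-sided one.\<close>

lemma nonincreasing_from_0:
  fixes g :: "real \<Rightarrow> real"
  assumes "\<And>s. 0 \<le> s \<Longrightarrow> (g has_real_derivative g' s) (at s within {0..})"
    and "\<And>s. 0 \<le> s \<Longrightarrow> g' s \<le> 0" and "0 \<le> t"
  shows "g t \<le> g 0"
proof (rule DERIV_nonpos_imp_decreasing_open[OF assms(3), of g])
  fix s :: real assume s: "0 < s" "s < t"
  then have "at s within {0..} = at s" by (intro at_within_nhd[of s "{0<..}"]) auto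
  then show "\<exists>y. (g has_real_derivative y) (at s) \<and> y \<le> 0"
    using assms(1)[of s] assms(2)[of s] s by auto
next
  have "continuous_on {0..} g"
    using assms(1) by (auto simp: continuous_on_eq_continuous_within intro: DERIV_continuous)
  then show "continuous_on {0..t} g" by (rule continuous_on_subset) auto
qed

text \<open>Near 0 the function is squeezed between \<open>- 2 * sqrt x\<close> and 0.\<close>

lemma continuous_on_mult_ln: "continuous_on {0..} (\<lambda>x::real. x * ln x)"
  unfolding continuous_on_eq_continuous_within
proof
  fix x :: real assume x: "x \<in> {0..}"
  show "continuous (at x within {0..}) (\<lambda>x. x * ln x)"
  proof (cases "x = 0")
    case True
    have "((\<lambda>x::real. x * ln x) \<longlongrightarrow> 0) (at_right 0)"
    proof (rule tendsto_sandwich)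
      have ev: "eventually (\<lambda>x. x \<in> {0<..<1}) (at_right (0::real))"
        by (rule eventually_at_right_real) simp
      then show "eventually (\<lambda>x. - 2 * sqrt x \<le> x * ln x) (at_right (0::real))"
      proof eventually_elim
        case (elim x)
        then have "ln (1 / sqrt x) \<le> 1 / sqrt x - 1"
          by (intro ln_le_minus_one) auto
        then have "- 2 / sqrt x \<le> ln x"
          using elim by (simp add: ln_div ln_sqrt)
        then have "x * (- 2 / sqrt x) \<le> x * ln x"
          using elim by (intro mult_left_mono) auto
        moreover have "x * (- 2 / sqrt x) = - 2 * (x / sqrt x)" by simp
        ultimately show ?case using elim real_div_sqrt[of x] by simp
      qed
      from ev show "eventually (\<lambda>x. x * ln x \<le> 0) (at_right (0::real))"
        by eventually_elim (simp add: mult_nonneg_nonpos)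
      show "((\<lambda>x::real. - 2 * sqrt x) \<longlongrightarrow> 0) (at_right 0)"
        by (rule tendsto_eq_intros refl | simp)+
    qed simp
    then show ?thesis
      by (simp add: True continuous_within at_within_Ici_at_right)
  next
    case False
    then show ?thesis using x by (intro continuous_intros) auto
  qed
qed

lemma rel_entropy_mixture_tendsto:
  assumes "\<And>z. z \<in> A \<Longrightarrow> 0 < \<zeta> z" "\<And>z. z \<in> A \<Longrightarrow> 0 \<le> p z" "\<And>z. z \<in> A \<Longrightarrow> 0 \<le> q z"
  shows "((\<lambda>\<epsilon>. rel_entropy A \<zeta> (\<lambda>z. ((1 - \<epsilon>) * p z + \<epsilon> * q z) / \<zeta> z))
    \<longlongrightarrow> rel_entropy A \<zeta> (\<lambda>z. p z / \<zeta> z)) (at_right 0)"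
  unfolding rel_entropy_def
proof (intro tendsto_sum tendsto_mult_right)
  fix z assume z: "z \<in> A"
  have "((\<lambda>\<epsilon>. ((1 - \<epsilon>) * p z + \<epsilon> * q z) / \<zeta> z) \<longlongrightarrow> ((1 - 0) * p z + 0 * q z) / \<zeta> z) (at_right 0)"
    using assms(1)[OF z] by (intro tendsto_intros) auto
  moreover have "eventually (\<lambda>\<epsilon>. \<epsilon> \<in> {0<..<1}) (at_right (0::real))"
    by (rule eventually_at_right_real) simp
  then have "eventually (\<lambda>\<epsilon>. ((1 - \<epsilon>) * p z + \<epsilon> * q z) / \<zeta> z \<in> {0..}) (at_right (0::real))"
    by eventually_elim (use assms z in \<open>auto intro!: divide_nonneg_pos add_nonneg_nonneg mult_nonneg_nonneg\<close>)
  ultimately have "((\<lambda>\<epsilon>. (\<lambda>x. x * ln x) (((1 - \<epsilon>) * p z + \<epsilon> * q z) / \<zeta> z))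
      \<longlongrightarrow> (\<lambda>x. x * ln x) (((1 - 0) * p z + 0 * q z) / \<zeta> z)) (at_right 0)"
    using assms z by (intro continuous_on_tendsto_compose[OF continuous_on_mult_ln])
      (auto intro: divide_nonneg_pos)
  then show "((\<lambda>\<epsilon>. ((1 - \<epsilon>) * p z + \<epsilon> * q z) / \<zeta> z * ln (((1 - \<epsilon>) * p z + \<epsilon> * q z) / \<zeta> z))
      \<longlongrightarrow> p z / \<zeta> z * ln (p z / \<zeta> z)) (at_right 0)"
    by simp
qed

text \<open>Inflow from other states is nonnegative, so multiplying by the integrating factor
  \<open>exp (- K z z * t)\<close> makes the component nondecreasing in time.\<close>

lemma kolmogorov_solution_pos:
  assumes "finite A" "generator_on A K" "kolmogorov_solution A K p" "z \<in> A" "0 < p 0 z" "0 \<le> t"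
  shows "0 < p t z"
proof -
  define k where "k = K z z"
  have "- (exp (- k * t) * p t z) \<le> - (exp (- k * 0) * p 0 z)"
  proof (rule nonincreasing_from_0[of "\<lambda>s. - (exp (- k * s) * p s z)"
        "\<lambda>s. - (exp (- k * s) * ((\<Sum>x\<in>A. K x z * p s x) - k * p s z))"])
    fix s :: real assume s: "0 \<le> s"
    have "((\<lambda>s. p s z) has_real_derivative (\<Sum>x\<in>A. K x z * p s x)) (at s within {0..})"
      using assms s by (auto simp: kolmogorov_solution_def)
    then show "((\<lambda>s. - (exp (- k * s) * p s z)) has_real_derivative
        - (exp (- k * s) * ((\<Sum>x\<in>A. K x z * p s x) - k * p s z))) (at s within {0..})"
      by (auto intro!: derivative_eq_intros simp: algebra_simps)
    have "0 \<le> K x z * p s x" if "x \<in> A - {z}" for x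
      using assms s that by (auto simp: kolmogorov_solution_def prob_on_def generator_on_def)
    then have "k * p s z \<le> (\<Sum>x\<in>A. K x z * p s x)"
      using sum_nonneg[of "A - {z}" "\<lambda>x. K x z * p s x"] by (simp add: sum.remove[OF assms(1,4)] k_def)
    then show "- (exp (- k * s) * ((\<Sum>x\<in>A. K x z * p s x) - k * p s z)) \<le> 0" by simp
  qed (use assms in auto)
  then have "p 0 z \<le> exp (- k * t) * p t z" by simp
  then have "0 < exp (- k * t) * p t z" using assms(5) by linarith
  then show ?thesis by (simp add: zero_less_mult_iff)
qed

text \<open>The equation is linear and \<open>\<rho>\<close> is a constant solution. For
  \<open>\<epsilon> > 0\<close> the mixture inherits strict positivity from a positive
  \<open>\<rho>\<close>.\<close>

lemma kolmogorov_solution_mixture: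
  assumes "kolmogorov_solution A K p" "\<rho> \<in> prob_on A" "steady_state_on A K \<rho>" "0 \<le> \<epsilon>" "\<epsilon> \<le> 1"
  shows "kolmogorov_solution A K (\<lambda>t z. (1 - \<epsilon>) * p t z + \<epsilon> * \<rho> z)"
  unfolding kolmogorov_solution_def
proof (intro allI impI conjI ballI)
  fix t :: real assume t: "0 \<le> t"
  show "(\<lambda>z. (1 - \<epsilon>) * p t z + \<epsilon> * \<rho> z) \<in> prob_on A"
    using assms t by (auto simp: kolmogorov_solution_def prob_on_def sum.distrib simp flip: sum_distrib_left)
  fix z assume z: "z \<in> A"
  have "(\<Sum>x\<in>A. K x z * ((1 - \<epsilon>) * p t x + \<epsilon> * \<rho> x))
      = (1 - \<epsilon>) * (\<Sum>x\<in>A. K x z * p t x) + \<epsilon> * (\<Sum>x\<in>A. K x z * \<rho> x)"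
    by (simp add: distrib_left sum.distrib sum_distrib_left mult_ac)
  also have "(\<Sum>x\<in>A. K x z * \<rho> x) = 0" using assms z by (simp add: steady_state_on_def)
  finally have eq: "(\<Sum>x\<in>A. K x z * ((1 - \<epsilon>) * p t x + \<epsilon> * \<rho> x)) = (1 - \<epsilon>) * (\<Sum>x\<in>A. K x z * p t x)"
    by simp
  have "((\<lambda>s. p s z) has_real_derivative (\<Sum>x\<in>A. K x z * p t x)) (at t within {0..})"
    using assms t z by (auto simp: kolmogorov_solution_def)
  then show "((\<lambda>s. (1 - \<epsilon>) * p s z + \<epsilon> * \<rho> z) has_real_derivative
      (\<Sum>x\<in>A. K x z * ((1 - \<epsilon>) * p t x + \<epsilon> * \<rho> x))) (at t within {0..})"
    unfolding eq by (auto intro!: derivative_eq_intros)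
qed

lemma rel_entropy_density:
  assumes "\<And>z. z \<in> A \<Longrightarrow> 0 < \<zeta> z"
  shows "rel_entropy A \<zeta> (\<lambda>z. p z / \<zeta> z) = (\<Sum>z\<in>A. p z * ln (p z / \<zeta> z))"
  unfolding rel_entropy_def using assms by (intro sum.cong refl) (force simp: field_simps)

lemma rel_entropy_density_nonneg:
  assumes "\<zeta> \<in> pos_prob_on A" "p \<in> pos_prob_on A"
  shows "0 \<le> rel_entropy A \<zeta> (\<lambda>z. p z / \<zeta> z)"
proof (rule rel_entropy_nonneg[OF assms(1)])
  have "(\<Sum>z\<in>A. p z / \<zeta> z * \<zeta> z) = (\<Sum>z\<in>A. p z)"
    using assms by (intro sum.cong) (auto simp: pos_prob_on_def)
  then show "(\<Sum>z\<in>A. p z / \<zeta> z * \<zeta> z) = 1"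
    using assms by (simp add: pos_prob_on_def prob_on_def)
qed (use assms in \<open>auto simp: pos_prob_on_def\<close>)

section \<open>Coarse-graining\<close>

lemma generator_row_sum:
  assumes "finite A" "generator_on A K" "x \<in> A"
  shows "(\<Sum>x'\<in>A - {x}. K x x') = - K x x"
  using assms by (simp add: generator_on_def sum.remove[OF assms(1,3)] add_eq_0_iff2)

lemma generator_diag_nonpos:
  assumes "finite A" "generator_on A K" "x \<in> A"
  shows "K x x \<le> 0"
proof -
  have "0 \<le> (\<Sum>x'\<in>A - {x}. K x x')"
    using assms by (intro sum_nonneg) (auto simp: generator_on_def)
  then show ?thesis by (simp add: generator_row_sum[OF assms])
qed

locale coarse_graining =
  fixes X :: "'a set" and Y :: "'b set" and \<xi> :: "'a \<Rightarrow> 'b"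
    and M :: "'a \<Rightarrow> 'a \<Rightarrow> real" and \<rho> :: "'a \<Rightarrow> real"
  assumes finite_X: "finite X" and finite_Y: "finite Y" and maps: "\<xi> \<in> X \<rightarrow> Y"
    and gen: "generator_on X M" and \<rho>: "\<rho> \<in> pos_prob_on X" and steady: "steady_state_on X M \<rho>"
    and level_nonempty: "\<And>y. y \<in> Y \<Longrightarrow> level_set X \<xi> y \<noteq> {}"
begin

text \<open>For a probability \<open>u\<close> on \<open>Y\<close>, the measure on \<open>X\<close>
  with marginal \<open>u\<close> and the stationary conditional measures on level sets.\<close>

definition lift :: "('b \<Rightarrow> real) \<Rightarrow> 'a \<Rightarrow> real" where
  "lift u x = u (\<xi> x) * cond_measure X \<xi> \<rho> (\<xi> x) x"

definition flow :: "('a \<Rightarrow> real) \<Rightarrow> 'a \<Rightarrow> real" where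
  "flow p x' = (\<Sum>x\<in>X. M x x' * p x)"

text \<open>A bound, depending on \<open>M\<close> alone, for the exit rate of every single
  state.\<close>

definition escape_rate :: real where
  "escape_rate = (\<Sum>x\<in>X. - M x x)"

lemma finite_level: "finite (level_set X \<xi> y)"
  using finite_X by (simp add: level_set_def)

lemma sum_level_sets: "(\<Sum>y\<in>Y. \<Sum>x\<in>level_set X \<xi> y. h x) = sum h X"
  unfolding level_set_def using sum.group[OF finite_X finite_Y, of \<xi> h] maps by auto

text \<open>Pushing measures forward along \<open>\<xi>\<close> is dual to pulling functions
  back.\<close>

lemma sum_coarse_mult: "(\<Sum>y\<in>Y. coarse X \<xi> p y * h y) = (\<Sum>x\<in>X. p x * h (\<xi> x))"
proof -
  have "(\<Sum>y\<in>Y. coarse X \<xi> p y * h y) = (\<Sum>y\<in>Y. \<Sum>x\<in>level_set X \<xi> y. p x * h (\<xi> x))"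
    unfolding coarse_def sum_distrib_right by (intro sum.cong refl) (simp add: level_set_def)
  then show ?thesis by (simp add: sum_level_sets)
qed

lemma sum_coarse: "(\<Sum>y\<in>Y. coarse X \<xi> p y) = sum p X"
  using sum_coarse_mult[of p "\<lambda>_. 1"] by simp

lemma coarse_pos:
  assumes "\<And>x. x \<in> X \<Longrightarrow> 0 < p x" "y \<in> Y"
  shows "0 < coarse X \<xi> p y"
  unfolding coarse_def using assms level_nonempty[OF assms(2)] finite_level
  by (intro sum_pos) (auto simp: level_set_def)

lemma coarse_nonneg:
  assumes "\<And>x. x \<in> X \<Longrightarrow> 0 \<le> p x"
  shows "0 \<le> coarse X \<xi> p y"
  unfolding coarse_def using assms by (intro sum_nonneg) (auto simp: level_set_def)

lemma coarse_pos_prob: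
  assumes "p \<in> pos_prob_on X"
  shows "coarse X \<xi> p \<in> pos_prob_on Y"
  using assms coarse_pos[of p] by (auto simp: pos_prob_on_def prob_on_def sum_coarse less_imp_le)

lemma coarse_\<rho>_pos: "y \<in> Y \<Longrightarrow> 0 < coarse X \<xi> \<rho> y"
  using \<rho> by (intro coarse_pos) (auto simp: pos_prob_on_def)

lemma cond_measure_eq: "cond_measure X \<xi> \<rho> y x = \<rho> x / coarse X \<xi> \<rho> y"
  by (simp add: cond_measure_def coarse_def)

lemma cond_pos_prob:
  assumes "y \<in> Y"
  shows "cond_measure X \<xi> \<rho> y \<in> pos_prob_on (level_set X \<xi> y)"
proof -
  have "(\<Sum>x\<in>level_set X \<xi> y. cond_measure X \<xi> \<rho> y x) = coarse X \<xi> \<rho> y / coarse X \<xi> \<rho> y"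
    unfolding cond_measure_eq by (subst (2) coarse_def) (rule sum_divide_distrib[symmetric])
  moreover have "0 < cond_measure X \<xi> \<rho> y x" if "x \<in> level_set X \<xi> y" for x
    using coarse_\<rho>_pos[OF assms] \<rho> that
    by (simp add: cond_measure_eq level_set_def pos_prob_on_def)
  ultimately show ?thesis
    using coarse_\<rho>_pos[OF assms] by (auto simp: pos_prob_on_def prob_on_def less_imp_le)
qed

lemma \<xi>_in_Y: "x \<in> X \<Longrightarrow> \<xi> x \<in> Y"
  using maps by auto

lemma lift_pos: "x \<in> X \<Longrightarrow> 0 < u (\<xi> x) \<Longrightarrow> 0 < lift u x"
  using cond_pos_prob[OF \<xi>_in_Y] by (simp add: lift_def pos_prob_on_def level_set_def)

lemma coarse_lift: "y \<in> Y \<Longrightarrow> coarse X \<xi> (lift u) y = u y"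
proof -
  assume y: "y \<in> Y"
  have "coarse X \<xi> (lift u) y = (\<Sum>x\<in>level_set X \<xi> y. u y * cond_measure X \<xi> \<rho> y x)"
    unfolding coarse_def by (intro sum.cong refl) (simp add: lift_def level_set_def)
  also have "\<dots> = u y"
    using cond_pos_prob[OF y] by (simp add: pos_prob_on_def prob_on_def flip: sum_distrib_left)
  finally show ?thesis .
qed

lemma sum_lift: "sum (lift u) X = sum u Y"
  unfolding sum_coarse[symmetric] by (intro sum.cong refl coarse_lift)

lemma generator_effective: "generator_on Y (effective_generator X \<xi> M \<rho>)"
  unfolding generator_on_def
proof (intro conjI ballI impI)
  fix y y' assume y: "y \<in> Y" "y' \<in> Y" "y \<noteq> y'"
  then show "0 \<le> effective_generator X \<xi> M \<rho> y y'"
    unfolding effective_generator_def using gen cond_pos_prob[OF y(1)]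
    by (intro sum_nonneg mult_nonneg_nonneg)
      (auto simp: level_set_def generator_on_def pos_prob_on_def prob_on_def)
next
  fix y assume y: "y \<in> Y"
  have "(\<Sum>y'\<in>Y. effective_generator X \<xi> M \<rho> y y') =
    (\<Sum>x\<in>level_set X \<xi> y. \<Sum>y'\<in>Y. \<Sum>x'\<in>level_set X \<xi> y'. M x x' * cond_measure X \<xi> \<rho> y x)"
    unfolding effective_generator_def by (rule sum.swap)
  also have "\<dots> = (\<Sum>x\<in>level_set X \<xi> y. (\<Sum>x'\<in>X. M x x') * cond_measure X \<xi> \<rho> y x)"
    by (simp add: sum_level_sets sum_distrib_right)
  also have "\<dots> = 0"
    using gen by (intro sum.neutral) (auto simp: level_set_def generator_on_def)
  finally show "(\<Sum>y'\<in>Y. effective_generator X \<xi> M \<rho> y y') = 0" .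
qed

text \<open>The effective dynamics is the full flow started from the lifted measure and then
  coarse-grained. Both evolutions are thereby expressed through \<open>M\<close>, so they can be
  compared jump by jump.\<close>

lemma effective_flow:
  "(\<Sum>y\<in>Y. effective_generator X \<xi> M \<rho> y y' * u y) = coarse X \<xi> (flow (lift u)) y'"
proof -
  have "(\<Sum>y\<in>Y. effective_generator X \<xi> M \<rho> y y' * u y) =
    (\<Sum>y\<in>Y. \<Sum>x\<in>level_set X \<xi> y. \<Sum>x'\<in>level_set X \<xi> y'. M x x' * lift u x)"
    unfolding effective_generator_def sum_distrib_right
    by (intro sum.cong refl) (auto simp: lift_def level_set_def)
  also have "\<dots> = coarse X \<xi> (flow (lift u)) y'"
    unfolding coarse_def flow_def sum_level_sets by (rule sum.swap)
  finally show ?thesis .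
qed

section \<open>Time derivatives of the entropies\<close>

lemma coarse_has_derivative:
  assumes "kolmogorov_solution X M \<mu>" "0 \<le> t"
  shows "((\<lambda>s. coarse X \<xi> (\<mu> s) y) has_real_derivative coarse X \<xi> (flow (\<mu> t)) y) (at t within {0..})"
  unfolding coarse_def flow_def
  using assms by (intro DERIV_sum) (auto simp: kolmogorov_solution_def level_set_def)

lemma sum_flow: "(\<Sum>x'\<in>X. flow p x' * h x') = (\<Sum>x\<in>X. \<Sum>x'\<in>X. M x x' * (p x * h x'))"
  unfolding flow_def sum_distrib_right by (subst sum.swap) (simp add: mult.assoc)

text \<open>Permits subtracting, under the double sum over jumps, any quantity that depends on the
  starting state only.\<close>

lemma row_sum: "(\<Sum>x\<in>X. \<Sum>x'\<in>X. M x x' * h x) = 0"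
  using gen by (auto simp: generator_on_def simp flip: sum_distrib_right)

text \<open>Adding the production to the left side leaves, in each jump, one term killed by
  stationarity of \<open>\<rho>\<close> and one killed by the row sums of \<open>M\<close>;
  \<open>term_eq\<close> is this splitting.\<close>

lemma dissipation_eq:
  assumes "\<And>x. x \<in> X \<Longrightarrow> 0 < p x"
  shows "(\<Sum>x\<in>X. flow p x * (ln (p x / \<rho> x) + 1)) = - entropy_production X M \<rho> (\<lambda>x. p x / \<rho> x)"
proof -
  define f where "f = (\<lambda>x. p x / \<rho> x)"
  have \<rho>pos: "0 < \<rho> x" if "x \<in> X" for x using \<rho> that by (simp add: pos_prob_on_def)
  have f: "0 < f x" "\<rho> x * f x = p x" if "x \<in> X" for x
    using \<rho>pos[OF that] assms[OF that] by (auto simp: f_def)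
  have term_eq: "M x x' * (p x * (ln (f x') + 1))
      + M x x' * \<rho> x * f x * (f x' / f x - 1 - ln (f x' / f x))
      = (M x x' * \<rho> x) * f x' + M x x' * (p x * ln (f x))"
    if "x \<in> X" "x' \<in> X" for x x'
  proof -
    have "M x x' * \<rho> x * f x * (f x' / f x - 1 - ln (f x' / f x))
      = (M x x' * \<rho> x) * (f x * (f x' / f x)) - M x x' * (\<rho> x * f x) * (1 + ln (f x') - ln (f x))"
    proof -
      have ln_eq: "ln (f x' / f x) = ln (f x') - ln (f x)"
        using f(1)[OF that(1)] f(1)[OF that(2)] by (simp add: ln_div)
      show ?thesis unfolding ln_eq by (simp add: algebra_simps)
    qed
    also have "f x * (f x' / f x) = f x'" using f[OF that(1)] by simp
    finally show ?thesis using f(2)[OF that(1)] by (simp add: algebra_simps)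
  qed
  have "(\<Sum>x\<in>X. flow p x * (ln (f x) + 1)) + entropy_production X M \<rho> f
    = (\<Sum>x\<in>X. \<Sum>x'\<in>X. (M x x' * \<rho> x) * f x' + M x x' * (p x * ln (f x)))"
    unfolding sum_flow entropy_production_def sum.distrib[symmetric]
    by (intro sum.cong refl) (use term_eq in simp)
  also have "\<dots> = (\<Sum>x'\<in>X. (\<Sum>x\<in>X. M x x' * \<rho> x) * f x') + (\<Sum>x\<in>X. \<Sum>x'\<in>X. M x x' * (p x * ln (f x)))"
    unfolding sum.distrib sum_distrib_right by (subst (1) sum.swap) simp
  also have "\<dots> = 0"
    using steady by (simp add: row_sum steady_state_on_def)
  finally show ?thesis by (simp add: f_def)
qed

text \<open>The left side is the time derivative of the relative entropy of \<open>m\<close> with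
  respect to \<open>\<eta>\<close>, with \<open>effective_flow\<close> inserted. Written over jumps,
  it involves the ratio \<open>m / \<eta>\<close> only through its quotient between end and start of
  a jump, which the dual bound eliminates.\<close>

lemma effective_derivative_le:
  assumes p: "p \<in> pos_prob_on X" and \<eta>: "\<And>y. y \<in> Y \<Longrightarrow> 0 < \<eta> y"
  defines "m \<equiv> coarse X \<xi> p"
  shows "(\<Sum>y\<in>Y. coarse X \<xi> (flow p) y * (ln (m y / \<eta> y) + 1)
      - coarse X \<xi> (flow (lift \<eta>)) y * (m y / \<eta> y))
    \<le> escape_rate * (\<Sum>x\<in>X. p x * ln (p x / lift m x))"
proof -
  define g where "g = (\<lambda>x. m (\<xi> x) / \<eta> (\<xi> x))"
  define e where "e = (\<lambda>x. p x * ln (p x / lift m x) - p x + lift m x)"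
  have ppos: "0 < p x" if "x \<in> X" for x using p that by (simp add: pos_prob_on_def)
  have mpos: "0 < m y" if "y \<in> Y" for y
    unfolding m_def using coarse_pos[of p y] ppos that by simp
  have gpos: "0 < g x" if "x \<in> X" for x
    using mpos \<eta> \<xi>_in_Y[OF that] by (simp add: g_def)
  have qpos: "0 < lift m x" if "x \<in> X" for x
    using lift_pos mpos \<xi>_in_Y[OF that] that by blast
  have q: "lift m x = lift \<eta> x * g x" if "x \<in> X" for x
    using \<eta>[OF \<xi>_in_Y[OF that]] by (simp add: lift_def g_def)
  \<comment> \<open>Legendre duality; the supremum over \<open>G\<close> is attained at \<open>G = p x / lift m x\<close>.\<close>
  have dual: "p x * ln G - lift m x * (G - 1) \<le> e x" if "x \<in> X" "0 < G" for x G
  proof -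
    have "ln (lift m x * G / p x) \<le> lift m x * G / p x - 1"
      using ppos qpos that by (intro ln_le_minus_one) auto
    then have "p x * ln (lift m x * G / p x) \<le> p x * (lift m x * G / p x - 1)"
      using ppos[OF that(1)] by (intro mult_left_mono) auto
    then show ?thesis
      using ppos[OF that(1)] qpos[OF that(1)] that(2)
      by (simp add: e_def ln_div ln_mult algebra_simps)
  qed
  have e_nonneg: "0 \<le> e x" if "x \<in> X" for x using dual[OF that, of 1] by simp
  \<comment> \<open>The bound is 0 on the diagonal, where the entry of \<open>M\<close> is
    nonpositive and the two brackets coincide.\<close>
  have edge: "M x x' * (p x * (ln (g x') + 1) - lift \<eta> x * g x')
      - M x x' * (p x * (ln (g x) + 1) - lift \<eta> x * g x)
      \<le> M x x' * (if x = x' then 0 else e x)" if x: "x \<in> X" "x' \<in> X" for x x'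
  proof -
    have "lift m x * (g x' / g x - 1) = lift \<eta> x * g x' - lift \<eta> x * g x"
      using q[OF x(1)] gpos[OF x(1)] by (simp add: algebra_simps)
    moreover have "ln (g x' / g x) = ln (g x') - ln (g x)"
      using gpos[OF x(1)] gpos[OF x(2)] by (simp add: ln_div)
    moreover have "p x * ln (g x' / g x) - lift m x * (g x' / g x - 1) \<le> e x"
      using gpos[OF x(1)] gpos[OF x(2)] by (intro dual[OF x(1)]) simp
    ultimately have "p x * (ln (g x') + 1) - lift \<eta> x * g x' - (p x * (ln (g x) + 1) - lift \<eta> x * g x)
      \<le> (if x = x' then 0 else e x)"
      by (auto simp: distrib_left right_diff_distrib)
    then show ?thesis
      unfolding right_diff_distrib[symmetric]
      by (intro offdiag_mult_mono[OF gen x]) auto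
  qed
  have "(\<Sum>y\<in>Y. coarse X \<xi> (flow p) y * (ln (m y / \<eta> y) + 1)
      - coarse X \<xi> (flow (lift \<eta>)) y * (m y / \<eta> y))
    = (\<Sum>x\<in>X. \<Sum>x'\<in>X. M x x' * (p x * (ln (g x') + 1) - lift \<eta> x * g x'))"
    unfolding sum_subtractf sum_coarse_mult sum_flow g_def[symmetric]
    by (simp add: g_def right_diff_distrib sum_subtractf)
  \<comment> \<open>The subtracted sum is 0 by \<open>row_sum\<close>; it turns values of
    \<open>g\<close> into increments along jumps.\<close>
  also have "\<dots> = (\<Sum>x\<in>X. \<Sum>x'\<in>X. M x x' * (p x * (ln (g x') + 1) - lift \<eta> x * g x')
      - M x x' * (p x * (ln (g x) + 1) - lift \<eta> x * g x))"
    unfolding sum_subtractf by (simp only: row_sum)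
  also have "\<dots> \<le> (\<Sum>x\<in>X. \<Sum>x'\<in>X. M x x' * (if x = x' then 0 else e x))"
    using edge by (intro sum_mono)
  also have "\<dots> = (\<Sum>x\<in>X. - M x x * e x)"
  proof (rule sum.cong[OF refl])
    fix x assume x: "x \<in> X"
    have "(\<Sum>x'\<in>X. M x x' * (if x = x' then 0 else e x)) = (\<Sum>x'\<in>X - {x}. M x x' * e x)"
      unfolding sum.remove[OF finite_X x] by (auto intro!: sum.cong split: if_splits)
    also have "\<dots> = (\<Sum>x'\<in>X - {x}. M x x') * e x" by (simp add: sum_distrib_right)
    also have "(\<Sum>x'\<in>X - {x}. M x x') = - M x x"
      by (rule generator_row_sum[OF finite_X gen x])
    finally show "(\<Sum>x'\<in>X. M x x' * (if x = x' then 0 else e x)) = - M x x * e x" .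
  qed
  also have "\<dots> \<le> (\<Sum>x\<in>X. escape_rate * e x)"
  proof (intro sum_mono mult_right_mono e_nonneg)
    fix x assume x: "x \<in> X"
    then show "- M x x \<le> escape_rate"
      unfolding escape_rate_def using generator_diag_nonpos[OF finite_X gen] finite_X
      by (intro member_le_sum[of x X "\<lambda>x. - M x x"]) auto
  qed
  also have "\<dots> = escape_rate * (\<Sum>x\<in>X. p x * ln (p x / lift m x))"
  proof -
    \<comment> \<open>Equal total masses cancel the linear terms of \<open>e\<close>.\<close>
    have "sum (lift m) X = sum p X" by (simp add: sum_lift m_def sum_coarse)
    then show ?thesis
      by (simp add: e_def sum.distrib sum_subtractf flip: sum_distrib_left)
  qed
  finally show ?thesis .
qed

end

section \<open>From the level sets to a monotone combination of entropies\<close>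

lemma generator_on_restricted:
  assumes "finite A" "\<And>x x'. x \<in> A \<Longrightarrow> x' \<in> A \<Longrightarrow> x \<noteq> x' \<Longrightarrow> 0 \<le> K x x'"
  shows "generator_on A (restricted_generator A K)"
  unfolding generator_on_def
proof (intro conjI ballI impI)
  fix x assume x: "x \<in> A"
  have "(\<Sum>x'\<in>A - {x}. restricted_generator A K x x') = (\<Sum>x'\<in>A - {x}. K x x')"
    by (intro sum.cong) (auto simp: restricted_generator_def)
  then show "(\<Sum>x'\<in>A. restricted_generator A K x x') = 0"
    unfolding sum.remove[OF assms(1) x] by (simp add: restricted_generator_def)
qed (use assms in \<open>auto simp: restricted_generator_def\<close>)

lemma has_derivative_mult_ln_div:
  fixes u v :: "real \<Rightarrow> real"
  assumes "(u has_real_derivative u') (at t within S)" "(v has_real_derivative v') (at t within S)"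
    and "0 < u t" "0 < v t"
  shows "((\<lambda>s. u s * ln (u s / v s)) has_real_derivative
    (u' * (ln (u t / v t) + 1) - v' * (u t / v t))) (at t within S)"
proof -
  have "((\<lambda>s. u s / v s) has_real_derivative (u' * v t - u t * v') / (v t * v t)) (at t within S)"
    using assms by (intro DERIV_divide) auto
  moreover have "0 < u t / v t" using assms by simp
  ultimately have "((\<lambda>s. ln (u s / v s)) has_real_derivative
      1 / (u t / v t) * ((u' * v t - u t * v') / (v t * v t))) (at t within S)"
    by (intro DERIV_chain2[OF DERIV_ln_divide])
  from DERIV_mult[OF assms(1) this]
  have "((\<lambda>s. u s * ln (u s / v s)) has_real_derivative
      u' * ln (u t / v t) + 1 / (u t / v t) * ((u' * v t - u t * v') / (v t * v t)) * u t) (at t within S)" .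
  moreover have "1 / (u t / v t) * ((u' * v t - u t * v') / (v t * v t)) * u t = u' - v' * (u t / v t)"
    using assms by (simp add: field_simps)
  ultimately show ?thesis by (simp only: distrib_left mult_1_right add_diff_eq)
qed

context coarse_graining
begin

lemma generator_level: "generator_on (level_set X \<xi> y) (restricted_generator (level_set X \<xi> y) M)"
  using gen by (intro generator_on_restricted finite_level) (auto simp: generator_on_def level_set_def)

text \<open>On each level set the log-Sobolev inequality is applied to the conditional density of
  \<open>p\<close>. Weighting with \<open>m y\<close> and summing gives the conditional entropy on
  one side; on the other, the part of the full production that comes from jumps within level
  sets.\<close>

lemma conditional_entropy_le_production:
  assumes p: "p \<in> pos_prob_on X"
    and a: "\<And>y. y \<in> Y \<Longrightarrow> ereal a \<le> gLSI (level_set X \<xi> y) (cond_measure X \<xi> \<rho> y)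
      (restricted_generator (level_set X \<xi> y) M)"
  shows "a * (\<Sum>x\<in>X. p x * ln (p x / lift (coarse X \<xi> p) x))
    \<le> entropy_production X M \<rho> (\<lambda>x. p x / \<rho> x)"
proof -
  define m where "m = coarse X \<xi> p"
  define f where "f = (\<lambda>x. p x / \<rho> x)"
  define W where "W = (\<lambda>z z'. M z z' * \<rho> z * f z * (f z' / f z - 1 - ln (f z' / f z)))"
  have ppos: "0 < p x" "0 < \<rho> x" if "x \<in> X" for x using p \<rho> that by (auto simp: pos_prob_on_def)
  have fpos: "0 < f x" if "x \<in> X" for x using ppos[OF that] by (simp add: f_def)
  have mpos: "0 < m y" if "y \<in> Y" for y
    unfolding m_def using coarse_pos[of p y] ppos that by simp
  have W_nonneg: "0 \<le> W z z'" if z: "z \<in> X" "z' \<in> X" for z z'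
  proof -
    have "M z z' * 0 \<le> M z z' * (\<rho> z * (f z * (f z' / f z - 1 - ln (f z' / f z))))"
    proof (rule offdiag_mult_mono[OF gen z])
      show "0 \<le> \<rho> z * (f z * (f z' / f z - 1 - ln (f z' / f z)))"
        using Bregman_nonneg[OF fpos fpos, OF z] ppos(2)[OF z(1)] by simp
    qed (use fpos[OF z(1)] in auto)
    then show ?thesis by (simp add: W_def mult.assoc)
  qed
  have level: "a * (\<Sum>x\<in>level_set X \<xi> y. p x * ln (p x / lift m x))
      \<le> (\<Sum>z\<in>level_set X \<xi> y. \<Sum>z'\<in>X. W z z')" if y: "y \<in> Y" for y
  proof -
    define A where "A = level_set X \<xi> y"
    define \<zeta> where "\<zeta> = cond_measure X \<xi> \<rho> y"
    define \<phi> where "\<phi> = (\<lambda>x. p x / (m y * \<zeta> x))"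
    have A: "x \<in> X" "\<xi> x = y" if "x \<in> A" for x using that by (auto simp: A_def level_set_def)
    have \<zeta>: "\<zeta> \<in> pos_prob_on A" unfolding \<zeta>_def A_def by (rule cond_pos_prob[OF y])
    then have \<zeta>pos: "0 < \<zeta> x" if "x \<in> A" for x using that by (simp add: pos_prob_on_def)
    have \<phi>\<zeta>: "m y * (\<phi> x * \<zeta> x) = p x" if "x \<in> A" for x
      using \<zeta>pos[OF that] mpos[OF y] by (simp add: \<phi>_def)
    have \<phi>pos: "0 < \<phi> x" if "x \<in> A" for x
      using \<zeta>pos[OF that] mpos[OF y] ppos A[OF that] by (simp add: \<phi>_def)
    \<comment> \<open>Within a level set the conditional density is a constant multiple of
      \<open>p / \<rho>\<close>, so both have the same ratios.\<close>
    have \<phi>f: "\<phi> x = coarse X \<xi> \<rho> y / m y * f x" for x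
      by (simp add: \<phi>_def \<zeta>_def f_def cond_measure_eq)
    have "m y * (\<Sum>x\<in>A. \<phi> x * \<zeta> x) = m y"
      unfolding sum_distrib_left using \<phi>\<zeta> by (simp add: A_def m_def coarse_def)
    then have mean: "(\<Sum>x\<in>A. \<phi> x * \<zeta> x) = 1" using mpos[OF y] by simp
    have "m y * rel_entropy A \<zeta> \<phi> = (\<Sum>x\<in>A. p x * ln (p x / lift m x))"
      unfolding rel_entropy_def sum_distrib_left
    proof (rule sum.cong[OF refl])
      fix x assume x: "x \<in> A"
      have "\<phi> x = p x / lift m x" using A[OF x] by (simp add: \<phi>_def lift_def \<zeta>_def)
      moreover have "m y * (\<phi> x * ln (\<phi> x) * \<zeta> x) = m y * (\<phi> x * \<zeta> x) * ln (\<phi> x)"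
        by (simp only: mult_ac)
      ultimately show "m y * (\<phi> x * ln (\<phi> x) * \<zeta> x) = p x * ln (p x / lift m x)"
        unfolding \<phi>\<zeta>[OF x] by metis
    qed
    moreover have "m y * entropy_production A (restricted_generator A M) \<zeta> \<phi> = (\<Sum>z\<in>A. \<Sum>z'\<in>A. W z z')"
      unfolding entropy_production_def sum_distrib_left
    proof (intro sum.cong refl)
      fix z z' assume z: "z \<in> A" "z' \<in> A"
      have "coarse X \<xi> \<rho> y / m y \<noteq> 0" using mpos[OF y] coarse_\<rho>_pos[OF y] by simp
      then have ratio: "\<phi> z' / \<phi> z = f z' / f z"
        unfolding \<phi>f by (rule mult_divide_mult_cancel_left)
      have weight: "m y * (\<phi> z * \<zeta> z) = \<rho> z * f z"
        using \<phi>\<zeta>[OF z(1)] ppos(2)[OF A(1)[OF z(1)]] by (simp add: f_def)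
      have "m y * (restricted_generator A M z z' * \<zeta> z * \<phi> z * (\<phi> z' / \<phi> z - 1 - ln (\<phi> z' / \<phi> z)))
        = restricted_generator A M z z' * (m y * (\<phi> z * \<zeta> z)) * (f z' / f z - 1 - ln (f z' / f z))"
        by (simp only: ratio mult_ac)
      \<comment> \<open>On the diagonal the bracket is 0, which hides the modified diagonal of the
        restricted generator.\<close>
      also have "\<dots> = W z z'"
        using fpos[OF A(1)[OF z(1)]]
        by (cases "z = z'") (auto simp: W_def weight restricted_generator_def)
      finally show "m y * (restricted_generator A M z z' * \<zeta> z * \<phi> z * (\<phi> z' / \<phi> z - 1 - ln (\<phi> z' / \<phi> z)))
        = W z z'" .
    qed
    moreover have "a * rel_entropy A \<zeta> \<phi> \<le> entropy_production A (restricted_generator A M) \<zeta> \<phi>"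
      using gLSI_le_entropy_production[OF _ \<zeta> _ \<phi>pos mean] generator_level a[OF y]
      unfolding A_def \<zeta>_def by blast
    then have "m y * (a * rel_entropy A \<zeta> \<phi>) \<le> m y * entropy_production A (restricted_generator A M) \<zeta> \<phi>"
      using mpos[OF y] by (intro mult_left_mono) auto
    ultimately have "a * (\<Sum>x\<in>A. p x * ln (p x / lift m x)) \<le> (\<Sum>z\<in>A. \<Sum>z'\<in>A. W z z')"
      by (simp add: mult.left_commute)
    \<comment> \<open>Jumps that leave the level set contribute nonnegative production.\<close>
    also have "\<dots> \<le> (\<Sum>z\<in>A. \<Sum>z'\<in>X. W z z')"
      using finite_X A W_nonneg by (intro sum_mono sum_mono2) auto
    finally show ?thesis by (simp add: A_def)
  qed
  have "a * (\<Sum>x\<in>X. p x * ln (p x / lift m x))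
      = (\<Sum>y\<in>Y. a * (\<Sum>x\<in>level_set X \<xi> y. p x * ln (p x / lift m x)))"
    by (simp only: sum_level_sets[symmetric] sum_distrib_left)
  also have "\<dots> \<le> (\<Sum>y\<in>Y. \<Sum>z\<in>level_set X \<xi> y. \<Sum>z'\<in>X. W z z')"
    using level by (intro sum_mono)
  also have "\<dots> = entropy_production X M \<rho> f"
    by (simp only: sum_level_sets entropy_production_def W_def)
  finally show ?thesis by (simp only: m_def f_def)
qed

text \<open>Chain rule for relative entropy: the total is the conditional part plus the entropy of
  the marginals, and the latter is nonnegative.\<close>

lemma conditional_entropy_le_total:
  assumes p: "p \<in> pos_prob_on X"
  shows "(\<Sum>x\<in>X. p x * ln (p x / lift (coarse X \<xi> p) x)) \<le> rel_entropy X \<rho> (\<lambda>x. p x / \<rho> x)"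
proof -
  define m where "m = coarse X \<xi> p"
  have ppos: "0 < p x" "0 < \<rho> x" if "x \<in> X" for x using p \<rho> that by (auto simp: pos_prob_on_def)
  have mpos: "0 < m y" if "y \<in> Y" for y
    unfolding m_def using coarse_pos[of p y] ppos that by simp
  have "p x * ln (p x / \<rho> x) = p x * ln (p x / lift m x)
      + p x * ln (m (\<xi> x) / coarse X \<xi> \<rho> (\<xi> x))" if x: "x \<in> X" for x
    using ppos[OF x] mpos[OF \<xi>_in_Y[OF x]] coarse_\<rho>_pos[OF \<xi>_in_Y[OF x]]
    by (simp add: lift_def cond_measure_eq ln_div ln_mult algebra_simps)
  then have "(\<Sum>x\<in>X. p x * ln (p x / \<rho> x)) = (\<Sum>x\<in>X. p x * ln (p x / lift m x))
      + (\<Sum>y\<in>Y. m y * ln (m y / coarse X \<xi> \<rho> y))"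
    unfolding sum_coarse_mult m_def by (simp add: sum.distrib)
  also have "(\<Sum>y\<in>Y. m y * ln (m y / coarse X \<xi> \<rho> y))
      = rel_entropy Y (coarse X \<xi> \<rho>) (\<lambda>y. m y / coarse X \<xi> \<rho> y)"
    using coarse_\<rho>_pos by (simp add: rel_entropy_density)
  finally show ?thesis
    using rel_entropy_density_nonneg[OF coarse_pos_prob[OF \<rho>] coarse_pos_prob[OF p]] ppos
    by (simp add: m_def rel_entropy_density)
qed

text \<open>Under \<open>bc\<close> the weighted sum of both entropies is a Lyapunov function. The
  weights stay free so that \<open>b = 1\<close> gives the main estimate and \<open>b = 0\<close>
  the decay of the full entropy.\<close>

lemma entropy_combination_le_pos:
  assumes \<mu>: "kolmogorov_solution X M \<mu>" and \<eta>: "kolmogorov_solution Y (effective_generator X \<xi> M \<rho>) \<eta>"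
    and \<mu>pos: "\<And>s x. 0 \<le> s \<Longrightarrow> x \<in> X \<Longrightarrow> 0 < \<mu> s x"
    and \<eta>pos: "\<And>s y. 0 \<le> s \<Longrightarrow> y \<in> Y \<Longrightarrow> 0 < \<eta> s y"
    and "0 \<le> b"
    and bc: "\<And>p. p \<in> pos_prob_on X \<Longrightarrow>
      b * (escape_rate * (\<Sum>x\<in>X. p x * ln (p x / lift (coarse X \<xi> p) x)))
      \<le> c * entropy_production X M \<rho> (\<lambda>x. p x / \<rho> x)"
    and "0 \<le> t"
  shows "b * rel_entropy Y (\<eta> t) (\<lambda>y. coarse X \<xi> (\<mu> t) y / \<eta> t y) + c * rel_entropy X \<rho> (\<lambda>x. \<mu> t x / \<rho> x)
    \<le> b * rel_entropy Y (\<eta> 0) (\<lambda>y. coarse X \<xi> (\<mu> 0) y / \<eta> 0 y) + c * rel_entropy X \<rho> (\<lambda>x. \<mu> 0 x / \<rho> x)"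
proof -
  have \<rho>pos: "0 < \<rho> x" if "x \<in> X" for x using \<rho> that by (simp add: pos_prob_on_def)
  define G where "G = (\<lambda>s. b * (\<Sum>y\<in>Y. coarse X \<xi> (\<mu> s) y * ln (coarse X \<xi> (\<mu> s) y / \<eta> s y))
    + c * (\<Sum>x\<in>X. \<mu> s x * ln (\<mu> s x / \<rho> x)))"
  define G' where "G' = (\<lambda>s. b * (\<Sum>y\<in>Y. coarse X \<xi> (flow (\<mu> s)) y * (ln (coarse X \<xi> (\<mu> s) y / \<eta> s y) + 1)
      - coarse X \<xi> (flow (lift (\<eta> s))) y * (coarse X \<xi> (\<mu> s) y / \<eta> s y))
    + c * (\<Sum>x\<in>X. flow (\<mu> s) x * (ln (\<mu> s x / \<rho> x) + 1)))"
  have "G t \<le> G 0"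
  proof (rule nonincreasing_from_0[of G G', OF _ _ assms(7)])
    fix s :: real assume s: "0 \<le> s"
    have "((\<lambda>s. coarse X \<xi> (\<mu> s) y * ln (coarse X \<xi> (\<mu> s) y / \<eta> s y)) has_real_derivative
        (coarse X \<xi> (flow (\<mu> s)) y * (ln (coarse X \<xi> (\<mu> s) y / \<eta> s y) + 1)
          - coarse X \<xi> (flow (lift (\<eta> s))) y * (coarse X \<xi> (\<mu> s) y / \<eta> s y))) (at s within {0..})"
      if y: "y \<in> Y" for y
    proof (rule has_derivative_mult_ln_div)
      show "((\<lambda>s. coarse X \<xi> (\<mu> s) y) has_real_derivative coarse X \<xi> (flow (\<mu> s)) y) (at s within {0..})"
        by (rule coarse_has_derivative[OF \<mu> s])
      show "((\<lambda>s. \<eta> s y) has_real_derivative coarse X \<xi> (flow (lift (\<eta> s))) y) (at s within {0..})"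
        using \<eta> s y unfolding kolmogorov_solution_def effective_flow by blast
      show "0 < coarse X \<xi> (\<mu> s) y" using coarse_pos[OF \<mu>pos[OF s] y] .
      show "0 < \<eta> s y" using \<eta>pos[OF s y] .
    qed
    \<comment> \<open>The reference \<open>\<rho> x\<close> is constant in time, hence the
      derivative 0 in the second slot.\<close>
    moreover have "((\<lambda>s. \<mu> s x * ln (\<mu> s x / \<rho> x)) has_real_derivative
        flow (\<mu> s) x * (ln (\<mu> s x / \<rho> x) + 1) - 0 * (\<mu> s x / \<rho> x)) (at s within {0..})"
      if x: "x \<in> X" for x
    proof (rule has_derivative_mult_ln_div)
      show "((\<lambda>s. \<mu> s x) has_real_derivative flow (\<mu> s) x) (at s within {0..})"
        using \<mu> s x unfolding kolmogorov_solution_def flow_def by blast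
    qed (use \<mu>pos[OF s x] \<rho>pos[OF x] in auto)
    ultimately show "(G has_real_derivative G' s) (at s within {0..})"
      unfolding G_def G'_def by (intro DERIV_add DERIV_cmult DERIV_sum) auto
    have p: "\<mu> s \<in> pos_prob_on X"
      using \<mu> \<mu>pos s by (simp add: pos_prob_on_def kolmogorov_solution_def)
    have diss: "(\<Sum>x\<in>X. flow (\<mu> s) x * (ln (\<mu> s x / \<rho> x) + 1))
        = - entropy_production X M \<rho> (\<lambda>x. \<mu> s x / \<rho> x)"
      by (rule dissipation_eq) (rule \<mu>pos[OF s])
    have "(\<Sum>y\<in>Y. coarse X \<xi> (flow (\<mu> s)) y * (ln (coarse X \<xi> (\<mu> s) y / \<eta> s y) + 1)
        - coarse X \<xi> (flow (lift (\<eta> s))) y * (coarse X \<xi> (\<mu> s) y / \<eta> s y))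
      \<le> escape_rate * (\<Sum>x\<in>X. \<mu> s x * ln (\<mu> s x / lift (coarse X \<xi> (\<mu> s)) x))"
      by (rule effective_derivative_le[OF p \<eta>pos[OF s]])
    from mult_left_mono[OF this \<open>0 \<le> b\<close>]
    have "G' s \<le> b * (escape_rate * (\<Sum>x\<in>X. \<mu> s x * ln (\<mu> s x / lift (coarse X \<xi> (\<mu> s)) x)))
      + c * (- entropy_production X M \<rho> (\<lambda>x. \<mu> s x / \<rho> x))"
      unfolding G'_def diss by simp
    then show "G' s \<le> 0" using bc[OF p] by simp
  qed
  moreover have "G s = b * rel_entropy Y (\<eta> s) (\<lambda>y. coarse X \<xi> (\<mu> s) y / \<eta> s y)
      + c * rel_entropy X \<rho> (\<lambda>x. \<mu> s x / \<rho> x)" if "0 \<le> s" for s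
    using \<eta>pos[OF that] \<rho>pos by (simp add: G_def rel_entropy_density)
  ultimately show ?thesis using \<open>0 \<le> t\<close> by simp
qed

lemma coarse_mixture:
  "coarse X \<xi> (\<lambda>x. (1 - \<epsilon>) * p x + \<epsilon> * q x) y = (1 - \<epsilon>) * coarse X \<xi> p y + \<epsilon> * coarse X \<xi> q y"
  by (simp add: coarse_def sum.distrib flip: sum_distrib_left)

text \<open>Only \<open>\<mu>\<close> is mixed with \<open>\<rho>\<close>; \<open>\<eta>\<close>
  starts positive and stays so by \<open>kolmogorov_solution_pos\<close>. Continuity of
  \<open>x * ln x\<close> at 0 carries the inequality to the limit.\<close>

lemma entropy_combination_le:
  assumes \<mu>: "kolmogorov_solution X M \<mu>" and \<eta>: "kolmogorov_solution Y (effective_generator X \<xi> M \<rho>) \<eta>"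
    and \<eta>0: "\<And>y. y \<in> Y \<Longrightarrow> 0 < \<eta> 0 y"
    and "0 \<le> b"
    and bc: "\<And>p. p \<in> pos_prob_on X \<Longrightarrow>
      b * (escape_rate * (\<Sum>x\<in>X. p x * ln (p x / lift (coarse X \<xi> p) x)))
      \<le> c * entropy_production X M \<rho> (\<lambda>x. p x / \<rho> x)"
    and "0 \<le> t"
  shows "b * rel_entropy Y (\<eta> t) (\<lambda>y. coarse X \<xi> (\<mu> t) y / \<eta> t y) + c * rel_entropy X \<rho> (\<lambda>x. \<mu> t x / \<rho> x)
    \<le> b * rel_entropy Y (\<eta> 0) (\<lambda>y. coarse X \<xi> (\<mu> 0) y / \<eta> 0 y) + c * rel_entropy X \<rho> (\<lambda>x. \<mu> 0 x / \<rho> x)"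
proof -
  have \<rho>pos: "0 < \<rho> x" if "x \<in> X" for x using \<rho> that by (simp add: pos_prob_on_def)
  have \<rho>prob: "\<rho> \<in> prob_on X" using \<rho> by (simp add: pos_prob_on_def)
  have \<mu>0: "0 \<le> \<mu> s x" if "0 \<le> s" "x \<in> X" for s x
    using \<mu> that by (auto simp: kolmogorov_solution_def prob_on_def)
  have \<eta>pos: "0 < \<eta> s y" if "0 \<le> s" "y \<in> Y" for s y
    by (rule kolmogorov_solution_pos[OF finite_Y generator_effective \<eta> that(2) \<eta>0[OF that(2)] that(1)])
  define \<mu>' where "\<mu>' = (\<lambda>\<epsilon> s x. (1 - \<epsilon>) * \<mu> s x + \<epsilon> * \<rho> x)"
  define L where "L = (\<lambda>\<epsilon> s. b * rel_entropy Y (\<eta> s) (\<lambda>y. coarse X \<xi> (\<mu>' \<epsilon> s) y / \<eta> s y)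
    + c * rel_entropy X \<rho> (\<lambda>x. \<mu>' \<epsilon> s x / \<rho> x))"
  have lim: "((\<lambda>\<epsilon>. L \<epsilon> s) \<longlongrightarrow> b * rel_entropy Y (\<eta> s) (\<lambda>y. coarse X \<xi> (\<mu> s) y / \<eta> s y)
    + c * rel_entropy X \<rho> (\<lambda>x. \<mu> s x / \<rho> x)) (at_right 0)" if s: "0 \<le> s" for s
    unfolding L_def \<mu>'_def coarse_mixture
  proof (intro tendsto_add tendsto_mult_left rel_entropy_mixture_tendsto \<eta>pos[OF s] \<rho>pos \<mu>0[OF s])
    show "0 \<le> coarse X \<xi> (\<mu> s) y" for y by (rule coarse_nonneg[OF \<mu>0[OF s]])
    show "0 \<le> coarse X \<xi> \<rho> y" for y by (rule coarse_nonneg[OF less_imp_le[OF \<rho>pos]])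
  qed (use \<rho>pos in \<open>auto simp: less_imp_le\<close>)
  have "eventually (\<lambda>\<epsilon>. \<epsilon> \<in> {0<..<1}) (at_right (0::real))"
    by (rule eventually_at_right_real) simp
  then have "eventually (\<lambda>\<epsilon>. L \<epsilon> t \<le> L \<epsilon> 0) (at_right (0::real))"
  proof eventually_elim
    case (elim \<epsilon>)
    show ?case unfolding L_def
    proof (rule entropy_combination_le_pos[OF _ \<eta> _ \<eta>pos \<open>0 \<le> b\<close> bc \<open>0 \<le> t\<close>])
      show "kolmogorov_solution X M (\<mu>' \<epsilon>)"
        unfolding \<mu>'_def using elim by (intro kolmogorov_solution_mixture[OF \<mu> \<rho>prob steady]) auto
      show "0 < \<mu>' \<epsilon> s x" if "0 \<le> s" "x \<in> X" for s x
        unfolding \<mu>'_def using elim \<mu>0[OF that] \<rho>pos[OF that(2)] by (intro add_nonneg_pos) auto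
    qed
  qed
  then show ?thesis
    using tendsto_le[OF _ lim[OF order_refl] lim[OF \<open>0 \<le> t\<close>]] by simp
qed

end

section \<open>Integrated entropy bounds\<close>

context coarse_graining
begin

lemma escape_rate_nonneg: "0 \<le> escape_rate"
  unfolding escape_rate_def using generator_diag_nonpos[OF finite_X gen] by (intro sum_nonneg) auto

text \<open>Irreducibility gives a positive Poincare constant on all of \<open>X\<close>, hence a
  positive \<open>gLSI\<close>; \<open>a\<close> is a real number strictly between 0 and it.\<close>

lemma log_Sobolev_of_irreducible:
  assumes "irreducible_on X M" "X \<noteq> {}"
  obtains a where "0 < a"
    "\<And>p. p \<in> pos_prob_on X \<Longrightarrow>
      a * rel_entropy X \<rho> (\<lambda>x. p x / \<rho> x) \<le> entropy_production X M \<rho> (\<lambda>x. p x / \<rho> x)"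
proof -
  define r where "r = 2 + ln (1 / (MIN x\<in>X. \<rho> x))"
  have "0 < r" using ln_inverse_min_nonneg[OF finite_X \<rho> assms(2)] by (simp add: r_def)
  then have "0 < poincare_constant X \<rho> (symmetrised_generator X \<rho> M) / ereal r"
    using poincare_constant_pos_of_irreducible[OF finite_X gen assms(1) \<rho>]
    by (cases "poincare_constant X \<rho> (symmetrised_generator X \<rho> M)") auto
  also have "\<dots> \<le> gLSI X \<rho> M"
    unfolding r_def by (rule poincare_le_gLSI[OF finite_X assms(2) gen \<rho>])
  finally have "0 < gLSI X \<rho> M" .
  then obtain a where a: "0 < ereal a" "ereal a < gLSI X \<rho> M"
    using ereal_dense2 by blast
  show thesis
  proof (rule that)
    show "0 < a" using a by simp
    fix p assume p: "p \<in> pos_prob_on X"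
    have "(\<Sum>x\<in>X. p x / \<rho> x * \<rho> x) = sum p X"
      using \<rho> by (intro sum.cong) (auto simp: pos_prob_on_def)
    then show "a * rel_entropy X \<rho> (\<lambda>x. p x / \<rho> x) \<le> entropy_production X M \<rho> (\<lambda>x. p x / \<rho> x)"
      using p \<rho> a by (intro gLSI_le_entropy_production[OF gen \<rho>])
        (auto simp: pos_prob_on_def prob_on_def)
  qed
qed

lemma entropy_bound_real:
  assumes \<mu>: "kolmogorov_solution X M \<mu>" and \<eta>: "kolmogorov_solution Y (effective_generator X \<xi> M \<rho>) \<eta>"
    and \<eta>0: "\<eta> 0 \<in> pos_prob_on Y" and "0 < a" "0 \<le> t"
    and a: "\<And>p. p \<in> pos_prob_on X \<Longrightarrow> a * (\<Sum>x\<in>X. p x * ln (p x / lift (coarse X \<xi> p) x))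
      \<le> entropy_production X M \<rho> (\<lambda>x. p x / \<rho> x)"
  shows "rel_entropy Y (\<eta> t) (\<lambda>y. coarse X \<xi> (\<mu> t) y / \<eta> t y)
    \<le> rel_entropy Y (\<eta> 0) (\<lambda>y. coarse X \<xi> (\<mu> 0) y / \<eta> 0 y)
      + escape_rate / a * (rel_entropy X \<rho> (\<lambda>x. \<mu> 0 x / \<rho> x) - rel_entropy X \<rho> (\<lambda>x. \<mu> t x / \<rho> x))"
proof -
  have "1 * (escape_rate * (\<Sum>x\<in>X. p x * ln (p x / lift (coarse X \<xi> p) x)))
      \<le> escape_rate / a * entropy_production X M \<rho> (\<lambda>x. p x / \<rho> x)"
    if "p \<in> pos_prob_on X" for p
    using mult_left_mono[OF a[OF that], of "escape_rate / a"] escape_rate_nonneg \<open>0 < a\<close> by simp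
  from entropy_combination_le[OF \<mu> \<eta> _ _ this \<open>0 \<le> t\<close>] \<eta>0 show ?thesis
    by (simp add: pos_prob_on_def right_diff_distrib)
qed

lemma entropy_nonincreasing:
  assumes \<mu>: "kolmogorov_solution X M \<mu>" and \<eta>: "kolmogorov_solution Y (effective_generator X \<xi> M \<rho>) \<eta>"
    and \<eta>0: "\<eta> 0 \<in> pos_prob_on Y" and "0 \<le> t"
  shows "rel_entropy X \<rho> (\<lambda>x. \<mu> t x / \<rho> x) \<le> rel_entropy X \<rho> (\<lambda>x. \<mu> 0 x / \<rho> x)"
proof -
  have "0 * (escape_rate * (\<Sum>x\<in>X. p x * ln (p x / lift (coarse X \<xi> p) x)))
      \<le> 1 * entropy_production X M \<rho> (\<lambda>x. p x / \<rho> x)"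
    if "p \<in> pos_prob_on X" for p
    using entropy_production_nonneg[OF gen \<rho>, of "\<lambda>x. p x / \<rho> x"] that \<rho> by (simp add: pos_prob_on_def)
  from entropy_combination_le[OF \<mu> \<eta> _ _ this \<open>0 \<le> t\<close>] \<eta>0 show ?thesis
    by (simp add: pos_prob_on_def)
qed

text \<open>A common form for both prefactors, with \<open>e\<close> either \<open>min_gLSI\<close>
  or \<open>explicit_const\<close>. The cases are \<open>e\<close> positive and finite, zero, and
  infinite. The 1 added to \<open>escape_rate\<close> keeps the numerator positive, so division by 0
  gives infinity.\<close>

lemma entropy_bound_ereal:
  fixes e :: ereal
  assumes \<mu>: "kolmogorov_solution X M \<mu>" and \<eta>: "kolmogorov_solution Y (effective_generator X \<xi> M \<rho>) \<eta>"
    and \<mu>0: "coarse X \<xi> (\<mu> 0) \<in> pos_prob_on Y" and \<eta>0: "\<eta> 0 \<in> pos_prob_on Y" and "0 \<le> t"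
    and irr: "irreducible_on X M" "X \<noteq> {}" and e: "0 \<le> e" "e \<le> min_gLSI X Y \<xi> M \<rho>"
  shows "ereal (rel_entropy Y (\<eta> t) (\<lambda>y. coarse X \<xi> (\<mu> t) y / \<eta> t y))
    \<le> ereal (2 * rel_entropy Y (\<eta> 0) (\<lambda>y. coarse X \<xi> (\<mu> 0) y / \<eta> 0 y))
      + ereal (escape_rate + 1) / e
        * ereal (rel_entropy X \<rho> (\<lambda>x. \<mu> 0 x / \<rho> x) - rel_entropy X \<rho> (\<lambda>x. \<mu> t x / \<rho> x))"
proof -
  define H where "H = (\<lambda>t. rel_entropy Y (\<eta> t) (\<lambda>y. coarse X \<xi> (\<mu> t) y / \<eta> t y))"
  define \<delta> where "\<delta> = rel_entropy X \<rho> (\<lambda>x. \<mu> 0 x / \<rho> x) - rel_entropy X \<rho> (\<lambda>x. \<mu> t x / \<rho> x)"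
  have "0 \<le> \<delta>" using entropy_nonincreasing[OF \<mu> \<eta> \<eta>0 \<open>0 \<le> t\<close>] by (simp add: \<delta>_def)
  have "0 \<le> H 0" unfolding H_def by (rule rel_entropy_density_nonneg[OF \<eta>0 \<mu>0])
  have real_bound: "H t \<le> H 0 + escape_rate / a * \<delta>"
    if "0 < a" "ereal a \<le> e" for a
    unfolding H_def \<delta>_def
  proof (rule entropy_bound_real[OF \<mu> \<eta> \<eta>0 \<open>0 < a\<close> \<open>0 \<le> t\<close> conditional_entropy_le_production])
    fix y assume "y \<in> Y"
    then have "min_gLSI X Y \<xi> M \<rho> \<le> gLSI (level_set X \<xi> y) (cond_measure X \<xi> \<rho> y)
      (restricted_generator (level_set X \<xi> y) M)"
      unfolding min_gLSI_def using finite_Y by (intro Min_le) auto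
    with that(2) e(2) show "ereal a \<le> gLSI (level_set X \<xi> y) (cond_measure X \<xi> \<rho> y)
      (restricted_generator (level_set X \<xi> y) M)" by order
  qed
  have "ereal (H t) \<le> ereal (2 * H 0) + ereal (escape_rate + 1) / e * ereal \<delta>"
  proof (cases e)
    case (real a)
    show ?thesis
    proof (cases "a = 0")
      case True
      show ?thesis
      proof (cases "\<delta> = 0")
        \<comment> \<open>Here the correction is \<open>\<infinity> * 0 = 0\<close>, so
          \<open>H t \<le> 2 * H 0\<close> must hold outright. The log-Sobolev inequality on all of
          \<open>X\<close> replaces those on level sets, and its constant drops out because it
          multiplies \<open>\<delta> = 0\<close>.\<close>
        case \<delta>0: True
        obtain a0 where a0: "0 < a0" "\<And>p. p \<in> pos_prob_on X \<Longrightarrow>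
          a0 * rel_entropy X \<rho> (\<lambda>x. p x / \<rho> x) \<le> entropy_production X M \<rho> (\<lambda>x. p x / \<rho> x)"
          using log_Sobolev_of_irreducible[OF irr] by blast
        have "a0 * (\<Sum>x\<in>X. p x * ln (p x / lift (coarse X \<xi> p) x))
            \<le> entropy_production X M \<rho> (\<lambda>x. p x / \<rho> x)" if p: "p \<in> pos_prob_on X" for p
          using mult_left_mono[OF conditional_entropy_le_total[OF p] less_imp_le[OF a0(1)]] a0(2)[OF p]
          by (rule order_trans)
        from entropy_bound_real[OF \<mu> \<eta> \<eta>0 a0(1) \<open>0 \<le> t\<close> this]
        have "H t \<le> H 0 + escape_rate / a0 * \<delta>" unfolding H_def \<delta>_def .
        then show ?thesis using \<open>0 \<le> H 0\<close> \<delta>0 by (simp flip: zero_ereal_def)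
      next
        case False
        then have "ereal (escape_rate + 1) / e * ereal \<delta> = \<infinity>"
          using True real \<open>0 \<le> \<delta>\<close> escape_rate_nonneg by (simp add: divide_ereal_def zero_ereal_def[symmetric])
        then show ?thesis by simp
      qed
    next
      case False
      then have "0 < a" using e(1) real by simp
      have "H t \<le> H 0 + escape_rate / a * \<delta>" using real_bound[of a] \<open>0 < a\<close> real by simp
      also have "\<dots> \<le> 2 * H 0 + (escape_rate + 1) / a * \<delta>"
        using \<open>0 \<le> H 0\<close> \<open>0 < a\<close> \<open>0 \<le> \<delta>\<close> by (intro add_mono mult_right_mono divide_right_mono) auto
      finally show ?thesis using \<open>0 < a\<close> real by simp
    qed
  next
    case PInf
    have "H t \<le> H 0"
    proof (rule field_le_epsilon)
      fix \<epsilon> :: real assume "0 < \<epsilon>"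
      \<comment> \<open>When \<open>e\<close> is infinite every positive \<open>a\<close> is
        allowed; this one makes the correction at most \<open>\<epsilon>\<close>, and the added 1
        keeps it positive.\<close>
      define a where "a = escape_rate * \<delta> / \<epsilon> + 1"
      have "0 < a" unfolding a_def using escape_rate_nonneg \<open>0 \<le> \<delta>\<close> \<open>0 < \<epsilon>\<close> by (intro add_nonneg_pos) auto
      have "escape_rate * \<delta> \<le> \<epsilon> * a" using \<open>0 < \<epsilon>\<close> by (simp add: a_def distrib_left)
      then have "escape_rate / a * \<delta> \<le> \<epsilon>" using \<open>0 < a\<close> by (simp add: field_simps)
      then show "H t \<le> H 0 + \<epsilon>" using real_bound[OF \<open>0 < a\<close>] PInf by simp
    qed
    then show ?thesis using PInf \<open>0 \<le> H 0\<close> by simp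
  next
    case MInf
    then show ?thesis using e(1) by simp
  qed
  then show ?thesis by (simp only: H_def \<delta>_def)
qed

section \<open>The explicit constant\<close>

lemma level_gap_nonneg:
  assumes "y \<in> Y"
  shows "0 \<le> level_gap X \<xi> M \<rho> y"
  unfolding level_gap_def
  by (rule poincare_constant_symmetrised_nonneg[OF generator_level cond_pos_prob[OF assms]])

lemma level_const_pos:
  assumes "y \<in> Y"
  shows "0 < 2 + ln (1 / (MIN x\<in>level_set X \<xi> y. cond_measure X \<xi> \<rho> y x))"
  using ln_inverse_min_nonneg[OF finite_level cond_pos_prob level_nonempty, OF assms assms] by simp

lemma explicit_const_nonneg:
  assumes "Y \<noteq> {}"
  shows "0 \<le> explicit_const X Y \<xi> M \<rho>"
  unfolding explicit_const_def
  using finite_Y assms zero_le_divide_ereal[OF level_gap_nonneg less_imp_le]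
    level_const_pos by simp

lemma explicit_const_pos:
  assumes "Y \<noteq> {}" "\<And>y. y \<in> Y \<Longrightarrow> 0 < level_gap X \<xi> M \<rho> y"
  shows "0 < explicit_const X Y \<xi> M \<rho>"
proof -
  have "0 < level_gap X \<xi> M \<rho> y / ereal (2 + ln (1 / (MIN x\<in>level_set X \<xi> y. cond_measure X \<xi> \<rho> y x)))"
    if "y \<in> Y" for y
    using assms(2)[OF that] level_const_pos[OF that] by (cases "level_gap X \<xi> M \<rho> y") auto
  then show ?thesis
    unfolding explicit_const_def using finite_Y assms(1) by simp
qed

lemma explicit_const_le_min_gLSI:
  assumes "Y \<noteq> {}"
  shows "explicit_const X Y \<xi> M \<rho> \<le> min_gLSI X Y \<xi> M \<rho>"
  unfolding min_gLSI_def
proof (rule Min.boundedI)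
  fix g assume "g \<in> (\<lambda>y. gLSI (level_set X \<xi> y) (cond_measure X \<xi> \<rho> y)
    (restricted_generator (level_set X \<xi> y) M)) ` Y"
  then obtain y where y: "y \<in> Y" and g: "g = gLSI (level_set X \<xi> y) (cond_measure X \<xi> \<rho> y)
    (restricted_generator (level_set X \<xi> y) M)" by auto
  have "explicit_const X Y \<xi> M \<rho> \<le> level_gap X \<xi> M \<rho> y
        / ereal (2 + ln (1 / (MIN x\<in>level_set X \<xi> y. cond_measure X \<xi> \<rho> y x)))"
    unfolding explicit_const_def using finite_Y y by (intro Min_le) auto
  also have "\<dots> \<le> g"
    unfolding g level_gap_def
    by (rule poincare_le_gLSI[OF finite_level level_nonempty[OF y] generator_level cond_pos_prob[OF y]])
  finally show "explicit_const X Y \<xi> M \<rho> \<le> g" .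
qed (use finite_Y assms in auto)

lemma explicit_const_pos_of_irreducible:
  assumes "Y \<noteq> {}"
    and "\<And>y. y \<in> Y \<Longrightarrow> irreducible_on (level_set X \<xi> y) (restricted_generator (level_set X \<xi> y) M)"
  shows "0 < explicit_const X Y \<xi> M \<rho>"
  using assms unfolding level_gap_def
  by (intro explicit_const_pos) (auto simp: level_gap_def
      intro!: poincare_constant_pos_of_irreducible finite_level generator_level cond_pos_prob)

text \<open>A positive log-Sobolev constant on a level set forces a positive gap there, so the
  explicit constant vanishes only if \<open>min_gLSI\<close> does.\<close>

lemma explicit_const_pos_of_min_gLSI:
  assumes "Y \<noteq> {}" "0 < min_gLSI X Y \<xi> M \<rho>"
  shows "0 < explicit_const X Y \<xi> M \<rho>"
proof (rule explicit_const_pos[OF assms(1)])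
  fix y assume y: "y \<in> Y"
  have "min_gLSI X Y \<xi> M \<rho> \<le> gLSI (level_set X \<xi> y) (cond_measure X \<xi> \<rho> y)
      (restricted_generator (level_set X \<xi> y) M)"
    unfolding min_gLSI_def using finite_Y y by (intro Min_le) auto
  with assms(2) show "0 < level_gap X \<xi> M \<rho> y"
    unfolding level_gap_def
    by (intro poincare_constant_pos_of_gLSI_pos finite_level generator_level cond_pos_prob[OF y]) order
qed

end

theorem proposition5p3:
  fixes X :: "'a set" and M :: "'a \<Rightarrow> 'a \<Rightarrow> real" and \<rho> :: "'a \<Rightarrow> real" and T c0 :: real
  assumes "finite X"
    and "generator_on X M" and "irreducible_on X M"
    and "\<rho> \<in> pos_prob_on X" and "steady_state_on X M \<rho>"
    and "0 < T" and "0 < c0"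
  shows "\<exists>C::real. 0 < C \<and>
    (\<forall>(Y :: 'b set) (\<xi> :: 'a \<Rightarrow> 'b) (\<mu> :: real \<Rightarrow> 'a \<Rightarrow> real) (\<eta> :: real \<Rightarrow> 'b \<Rightarrow> real).
       finite Y \<and> \<xi> \<in> X \<rightarrow> Y
       \<and> kolmogorov_solution X M \<mu>
       \<and> kolmogorov_solution Y (effective_generator X \<xi> M \<rho>) \<eta>
       \<and> coarse X \<xi> (\<mu> 0) \<in> pos_prob_on Y \<and> \<eta> 0 \<in> pos_prob_on Y
       \<and> (\<forall>y\<in>Y. c0 \<le> coarse X \<xi> (\<mu> 0) y \<and> c0 \<le> \<eta> 0 y)
       \<longrightarrow>
         (\<forall>t\<in>{0..T}.
            ereal (rel_entropy Y (\<eta> t) (\<lambda>y. coarse X \<xi> (\<mu> t) y / \<eta> t y))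
            \<le> ereal (2 * rel_entropy Y (\<eta> 0) (\<lambda>y. coarse X \<xi> (\<mu> 0) y / \<eta> 0 y))
              + ereal C / min_gLSI X Y \<xi> M \<rho>
                * ereal (rel_entropy X \<rho> (\<lambda>x. \<mu> 0 x / \<rho> x) - rel_entropy X \<rho> (\<lambda>x. \<mu> t x / \<rho> x)))
       \<and> (\<forall>t\<in>{0..T}.
            ereal (rel_entropy Y (\<eta> t) (\<lambda>y. coarse X \<xi> (\<mu> t) y / \<eta> t y))
            \<le> ereal (2 * rel_entropy Y (\<eta> 0) (\<lambda>y. coarse X \<xi> (\<mu> 0) y / \<eta> 0 y))
              + ereal C / explicit_const X Y \<xi> M \<rho>
                * ereal (rel_entropy X \<rho> (\<lambda>x. \<mu> 0 x / \<rho> x) - rel_entropy X \<rho> (\<lambda>x. \<mu> t x / \<rho> x)))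
       \<and> ((\<forall>y\<in>Y. irreducible_on (level_set X \<xi> y) (restricted_generator (level_set X \<xi> y) M))
            \<longrightarrow> 0 < explicit_const X Y \<xi> M \<rho>)
       \<and> (0 < min_gLSI X Y \<xi> M \<rho> \<longrightarrow> 0 < explicit_const X Y \<xi> M \<rho>))"
\<comment> \<open>The witness is \<open>escape_rate + 1\<close> written out, since the locale can be
  interpreted only once \<open>Y\<close> and \<open>\<xi>\<close> are fixed.\<close>
proof (intro exI[of _ "(\<Sum>x\<in>X. - M x x) + 1"] conjI allI impI)
  show "0 < (\<Sum>x\<in>X. - M x x) + 1"
    using generator_diag_nonpos[OF assms(1,2)] by (intro add_nonneg_pos sum_nonneg) auto
next
  fix Y :: "'b set" and \<xi> :: "'a \<Rightarrow> 'b" and \<mu> :: "real \<Rightarrow> 'a \<Rightarrow> real" and \<eta> :: "real \<Rightarrow> 'b \<Rightarrow> real"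
  assume *: "finite Y \<and> \<xi> \<in> X \<rightarrow> Y
       \<and> kolmogorov_solution X M \<mu>
       \<and> kolmogorov_solution Y (effective_generator X \<xi> M \<rho>) \<eta>
       \<and> coarse X \<xi> (\<mu> 0) \<in> pos_prob_on Y \<and> \<eta> 0 \<in> pos_prob_on Y
       \<and> (\<forall>y\<in>Y. c0 \<le> coarse X \<xi> (\<mu> 0) y \<and> c0 \<le> \<eta> 0 y)"
  interpret coarse_graining X Y \<xi> M \<rho>
  proof
    fix y assume "y \<in> Y"
    \<comment> \<open>An empty level set would carry mass 0.\<close>
    then have "0 < coarse X \<xi> (\<mu> 0) y" using * by (simp add: pos_prob_on_def)
    then show "level_set X \<xi> y \<noteq> {}" by (auto simp: coarse_def)
  qed (use * assms in auto)
  have Y: "Y \<noteq> {}" using * by (auto simp: pos_prob_on_def prob_on_def)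
  have X: "X \<noteq> {}" using assms(4) by (auto simp: pos_prob_on_def prob_on_def)
  have bound: "ereal (rel_entropy Y (\<eta> t) (\<lambda>y. coarse X \<xi> (\<mu> t) y / \<eta> t y))
    \<le> ereal (2 * rel_entropy Y (\<eta> 0) (\<lambda>y. coarse X \<xi> (\<mu> 0) y / \<eta> 0 y))
      + ereal ((\<Sum>x\<in>X. - M x x) + 1) / e
        * ereal (rel_entropy X \<rho> (\<lambda>x. \<mu> 0 x / \<rho> x) - rel_entropy X \<rho> (\<lambda>x. \<mu> t x / \<rho> x))"
    if "t \<in> {0..T}" "0 \<le> e" "e \<le> min_gLSI X Y \<xi> M \<rho>" for t e
    using entropy_bound_ereal[of \<mu> \<eta> t e] * assms(3) X that by (simp add: escape_rate_def)
  show "(\<forall>t\<in>{0..T}.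
            ereal (rel_entropy Y (\<eta> t) (\<lambda>y. coarse X \<xi> (\<mu> t) y / \<eta> t y))
            \<le> ereal (2 * rel_entropy Y (\<eta> 0) (\<lambda>y. coarse X \<xi> (\<mu> 0) y / \<eta> 0 y))
              + ereal ((\<Sum>x\<in>X. - M x x) + 1) / min_gLSI X Y \<xi> M \<rho>
                * ereal (rel_entropy X \<rho> (\<lambda>x. \<mu> 0 x / \<rho> x) - rel_entropy X \<rho> (\<lambda>x. \<mu> t x / \<rho> x)))"
    \<comment> \<open>Nonnegativity of \<open>min_gLSI\<close> follows from that of the smaller
      \<open>explicit_const\<close>.\<close>
    using bound explicit_const_nonneg[OF Y] explicit_const_le_min_gLSI[OF Y] by (blast intro: order_trans)
  show "(\<forall>t\<in>{0..T}.
            ereal (rel_entropy Y (\<eta> t) (\<lambda>y. coarse X \<xi> (\<mu> t) y / \<eta> t y))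
            \<le> ereal (2 * rel_entropy Y (\<eta> 0) (\<lambda>y. coarse X \<xi> (\<mu> 0) y / \<eta> 0 y))
              + ereal ((\<Sum>x\<in>X. - M x x) + 1) / explicit_const X Y \<xi> M \<rho>
                * ereal (rel_entropy X \<rho> (\<lambda>x. \<mu> 0 x / \<rho> x) - rel_entropy X \<rho> (\<lambda>x. \<mu> t x / \<rho> x)))"
    using bound explicit_const_nonneg[OF Y] explicit_const_le_min_gLSI[OF Y] by blast
  show "0 < explicit_const X Y \<xi> M \<rho>"
    if "\<forall>y\<in>Y. irreducible_on (level_set X \<xi> y) (restricted_generator (level_set X \<xi> y) M)"
    using explicit_const_pos_of_irreducible[OF Y] that by blast
  show "0 < explicit_const X Y \<xi> M \<rho>" if "0 < min_gLSI X Y \<xi> M \<rho>"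
    by (rule explicit_const_pos_of_min_gLSI[OF Y that])
qed

end
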